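(* Fix $\omega\in\mathbb{F}_{q^2}\setminus\mathbb{F}_q$. For $s_{11}\in\mathbb{C}_\infty$ let $L(s_{11})$ be the lattice of rank $3$ in $\mathbb{C}_\infty^2$ having Siegel matrix $(s_{11},\ \omega)$, i.e. a lattice with an $\mathbb{F}_q[\theta]$-basis $l_1,l_2,l_3$ such that $l_1,l_2$ is a $\mathbb{C}_\infty$-basis of $\mathbb{C}_\infty^2$ and $l_3=s_{11}l_1+\omega l_2$. Then there is a neighborhood $U$ of $0$ in $\mathbb{C}_\infty$ such that for every $s_{11}\in U$ there exist $a_{11},a_{12},a_{21}\in\mathbb{C}_\infty$ such that the t-motive $M$, free over $\mathbb{C}_\infty\{\tau\}$ with basis $e_1,e_2$ and with $$T\begin{pmatrix}e_1\\ e_2\end{pmatrix}=\theta\begin{pmatrix}e_1\\ e_2\end{pmatrix}+\begin{pmatrix}a_{11}&a_{12}\\ a_{21}&1\end{pmatrix}\tau\begin{pmatrix}e_1\\ e_2\end{pmatrix}+\begin{pmatrix}1&0\\0&0\end{pmatrix}\tau^2\begin{pmatrix}e_1\\ e_2\end{pmatrix},$$ is uniformizable and $L(M)$ is isomorphic to $L(s_{11})$.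
   Context: $q$ is a power of a prime, $\theta$ is transcendental over $\mathbb{F}_q$, $\mathbb{R}_\infty=\mathbb{F}_q((1/\theta))$ with valuation $v_\infty(\theta)=-1$, and $\mathbb{C}_\infty$ is the completion of an algebraic closure of $\mathbb{R}_\infty$. The Anderson ring $\mathbb{C}_\infty[T,\tau]$ is the noncommutative polynomial ring with relations $aT=Ta$, $\tau T=T\tau$, $\tau a=a^q\tau$ for $a\in\mathbb{C}_\infty$; $\mathbb{C}_\infty\{\tau\}$ is its subring of polynomials in $\tau$. An Anderson t-motive is a left $\mathbb{C}_\infty[T,\tau]$-module $M$ free of finite rank $r$ over $\mathbb{C}_\infty[T]$ and free of finite rank $n$ over $\mathbb{C}_\infty\{\tau\}$, with $T-\theta$ nilpotent on $M/\tau M$; the t-motives considered have $Te_*=\theta e_*+A_1\tau e_*+\dots+A_k\tau^k e_*$ ($A_i\in M_{n\times n}(\mathbb{C}_\infty)$) for a $\mathbb{C}_\infty\{\tau\}$-basis $e_*=(e_1,\dots,e_n)^t$ (the $M$ in the claim has $r=3$, $n=2$). For $Z\in\mathbb{C}_\infty^n$ let $Z^{(k)}$ denote raising each entry to the $q^k$-th power and $T(Z)=\theta Z+A_1Z^{(1)}+\dots+A_kZ^{(k)}$. There is a unique map $\exp_M(Z)=Z+C_1Z^{(1)}+C_2Z^{(2)}+\cdots$ ($C_i\in M_{n\times n}(\mathbb{C}_\infty)$) with $\exp_M(\theta Z)=T(\exp_M(Z))$; $L(M)=\ker\exp_M$ is an $\mathbb{F}_q[\theta]$-module of rank $\le r$,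 and $M$ is uniformizable if the rank is $r$. A lattice of rank $r$ in $\mathbb{C}_\infty^n$ is a subgroup isomorphic to $\mathbb{F}_q[\theta]^r$ whose $\mathbb{C}_\infty$-span is $\mathbb{C}_\infty^n$ and whose $\mathbb{R}_\infty$-span has $\mathbb{R}_\infty$-dimension $r$; lattices are isomorphic if a $\mathbb{C}_\infty$-linear isomorphism of the ambient spaces maps one onto the other. If $l_1,\dots,l_r$ is an $\mathbb{F}_q[\theta]$-basis of a lattice with $l_1,\dots,l_n$ a $\mathbb{C}_\infty$-basis of $\mathbb{C}_\infty^n$, its Siegel matrix $S\in M_{(r-n)\times n}(\mathbb{C}_\infty)$ is defined by $(l_{n+1},\dots,l_r)^t=S\,(l_1,\dots,l_n)^t$. (Since $\omega\notin\mathbb{R}_\infty$, $(s_{11},\omega)$ is indeed the Siegel matrix of a lattice for every $s_{11}$.) *)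

theory Defs
  imports "HOL-Analysis.Analysis" "HOL-Computational_Algebra.Formal_Laurent_Series"
begin

definition absval :: "'c::{field,metric_space} \<Rightarrow> real" where
  "absval x = dist x 0"

text \<open>
  The type \<open>'k\<close> is the field with \<open>q = CARD('k)\<close> elements, and \<open>'k fls\<close> is the field of Laurent
  series in the uniformizer \<open>fls_X = 1/\<theta>\<close>, so that \<open>\<theta>\<close> is \<open>fls_X_inv\<close>. The absolute value attached
  to the valuation \<open>v\<close> is \<open>q powr (- v)\<close>. The locale says that \<open>'c\<close> is a completion of an algebraic
  closure of \<open>'k fls\<close>, embedded by \<open>\<iota>\<close>: the metric of \<open>'c\<close> is complete and comes from an absolute value
  extending the one of \<open>'k fls\<close>, and the elements algebraic over \<open>'k fls\<close> (an algebraic closure of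
  \<open>'k fls\<close>, as \<open>'c\<close> is algebraically closed) are dense. That the completion of the algebraic closure
  is again algebraically closed is Krasner's theorem; it is recorded in the sort of \<open>'c\<close>.
\<close>

locale C_infty =
  fixes \<iota> :: "'k::finite_field fls \<Rightarrow> 'c::{alg_closed_field,complete_space}"
  assumes embed_one: "\<iota> 1 = 1"
    and embed_add: "\<iota> (f + g) = \<iota> f + \<iota> g"
    and embed_mult: "\<iota> (f * g) = \<iota> f * \<iota> g"
    and dist_absval: "dist (x :: 'c) y = absval (x - y)"
    and absval_mult: "absval (x * y :: 'c) = absval x * absval y"
    and absval_add: "absval (x + y :: 'c) \<le> max (absval x) (absval y)"
    and absval_embed:
      "f \<noteq> 0 \<Longrightarrow> absval (\<iota> f) = real CARD('k) powr (- real_of_int (fls_subdegree f))"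
    and algebraic_dense:
      "closure {y. \<exists>p :: 'k fls poly. p \<noteq> 0 \<and> poly (map_poly \<iota> p) y = 0} = UNIV"

definition theta :: "('k::finite_field fls \<Rightarrow> 'c) \<Rightarrow> 'c" where
  "theta \<iota> = \<iota> fls_X_inv"

definition F_q :: "('k::finite_field fls \<Rightarrow> 'c) \<Rightarrow> 'c set" where
  "F_q \<iota> = range (\<lambda>c. \<iota> (fls_const c))"

text \<open>The subfield with \<open>q\<^sup>2\<close> elements of the algebraically closed field \<open>'c\<close>.\<close>

definition F_q2 :: "('k::finite_field fls \<Rightarrow> 'c::field) \<Rightarrow> 'c set" where
  "F_q2 \<iota> = {x. x ^ (CARD('k)\<^sup>2) = x}"

text \<open>
  A left module over the Anderson ring, given by the action of the scalars and of the two generators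
  \<open>T\<close> and \<open>\<tau>\<close>; its underlying group is the whole type \<open>'m\<close>.
\<close>

record ('c, 'm) anderson_module =
  act_scalar :: "'c \<Rightarrow> 'm \<Rightarrow> 'm"
  act_T :: "'m \<Rightarrow> 'm"
  act_tau :: "'m \<Rightarrow> 'm"

definition is_anderson_module :: "nat \<Rightarrow> ('c::field, 'm::ab_group_add) anderson_module \<Rightarrow> bool" where
  "is_anderson_module q M \<longleftrightarrow>
     vector_space (act_scalar M) \<and>
     (\<forall>x y. act_T M (x + y) = act_T M x + act_T M y) \<and>
     (\<forall>x y. act_tau M (x + y) = act_tau M x + act_tau M y) \<and>
     (\<forall>a x. act_scalar M a (act_T M x) = act_T M (act_scalar M a x)) \<and>
     (\<forall>x. act_tau M (act_T M x) = act_T M (act_tau M x)) \<and>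
     (\<forall>a x. act_tau M (act_scalar M a x) = act_scalar M (a ^ q) (act_tau M x))"

text \<open>
  The action of \<open>\<Sum>j. coeff p j F\<^sup>j\<close>, coefficients on the left, where \<open>F\<close> is the action of \<open>T\<close> or of
  \<open>\<tau>\<close>. For \<open>F = act_tau M\<close> the type \<open>'c poly\<close> only serves as the set of left polynomials in \<open>\<tau>\<close>; its
  commutative multiplication plays no role.
\<close>

definition act_poly ::
    "('c::field, 'm::ab_group_add) anderson_module \<Rightarrow> ('m \<Rightarrow> 'm) \<Rightarrow> 'c poly \<Rightarrow> 'm \<Rightarrow> 'm" where
  "act_poly M F p x = (\<Sum>j\<le>degree p. act_scalar M (coeff p j) ((F ^^ j) x))"

definition is_free_basis ::
    "('c::field, 'm::ab_group_add) anderson_module \<Rightarrow> ('m \<Rightarrow> 'm) \<Rightarrow> 'i set \<Rightarrow> ('i \<Rightarrow> 'm) \<Rightarrow> bool" where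
  "is_free_basis M F I e \<longleftrightarrow>
     (\<forall>x. \<exists>!p. (\<forall>i. i \<notin> I \<longrightarrow> p i = 0) \<and> x = (\<Sum>i\<in>I. act_poly M F (p i) (e i)))"

definition free_of_rank ::
    "('c::field, 'm::ab_group_add) anderson_module \<Rightarrow> ('m \<Rightarrow> 'm) \<Rightarrow> nat \<Rightarrow> bool" where
  "free_of_rank M F r \<longleftrightarrow> (\<exists>e :: nat \<Rightarrow> 'm. is_free_basis M F {..<r} e)"

definition is_t_motive ::
    "('k::finite_field fls \<Rightarrow> 'c::field) \<Rightarrow> nat \<Rightarrow> nat \<Rightarrow> ('c, 'm::ab_group_add) anderson_module \<Rightarrow> bool"
  where
  "is_t_motive \<iota> r n M \<longleftrightarrow>
     is_anderson_module CARD('k) M \<and>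
     free_of_rank M (act_T M) r \<and>
     free_of_rank M (act_tau M) n \<and>
     (\<exists>N. \<forall>x. ((\<lambda>y. act_T M y - act_scalar M (theta \<iota>) y) ^^ N) x \<in> range (act_tau M))"

text \<open>
  \<open>e\<close> is a basis over the polynomials in \<open>\<tau>\<close> and \<open>T e = \<theta> e + A\<^sub>1 \<tau> e + \<dots> + A\<^sub>k \<tau>\<^sup>k e\<close>, where
  \<open>As = [A\<^sub>1, \<dots>, A\<^sub>k]\<close>.
\<close>

definition is_presentation ::
    "('k::finite_field fls \<Rightarrow> 'c::field) \<Rightarrow> ('c, 'm::ab_group_add) anderson_module \<Rightarrow>
      ('c^'n^'n) list \<Rightarrow> ('n::finite \<Rightarrow> 'm) \<Rightarrow> bool" where
  "is_presentation \<iota> M As e \<longleftrightarrow>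
     is_free_basis M (act_tau M) UNIV e \<and>
     (\<forall>i. act_T M (e i) = act_scalar M (theta \<iota>) (e i) +
        (\<Sum>k<length As. \<Sum>j\<in>UNIV. act_scalar M (As ! k $ i $ j) ((act_tau M ^^ Suc k) (e j))))"

definition frob :: "nat \<Rightarrow> nat \<Rightarrow> 'c::field^'n \<Rightarrow> 'c^'n" where
  "frob q k Z = (\<chi> i. (Z $ i) ^ (q ^ k))"

definition T_map :: "('k::finite_field fls \<Rightarrow> 'c::field) \<Rightarrow> ('c^'n^'n) list \<Rightarrow> 'c^'n \<Rightarrow> 'c^'n" where
  "T_map \<iota> As Z = theta \<iota> *s Z + (\<Sum>k<length As. (As ! k) *v frob CARD('k) (Suc k) Z)"

text \<open>
  \<open>exp_map \<iota> As\<close> and \<open>L_module \<iota> As\<close> are the exponential and its kernel for a t-motive presented by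
  \<open>As\<close> in the sense of \<open>is_presentation\<close>; another basis changes them by a linear isomorphism.
\<close>

definition exp_map ::
    "('k::finite_field fls \<Rightarrow> 'c::{field,topological_space}) \<Rightarrow> ('c^'n^'n) list \<Rightarrow> 'c^'n \<Rightarrow> 'c^'n" where
  "exp_map \<iota> As = (THE f.
     (\<exists>C. C 0 = mat 1 \<and> (\<forall>Z. (\<lambda>i. C i *v frob CARD('k) i Z) sums f Z)) \<and>
     (\<forall>Z. f (theta \<iota> *s Z) = T_map \<iota> As (f Z)))"

definition L_module ::
    "('k::finite_field fls \<Rightarrow> 'c::{field,topological_space}) \<Rightarrow> ('c^'n^'n) list \<Rightarrow> ('c^'n) set" where
  "L_module \<iota> As = {Z. exp_map \<iota> As Z = 0}"

text \<open>The scalar actions of \<open>'k fls\<close> and of \<open>'k poly\<close>, the latter being identified with the subring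
  generated by \<open>\<theta>\<close> over the constants through the substitution of \<open>\<theta>\<close> for the variable.\<close>

definition R_scale :: "('k::finite_field fls \<Rightarrow> 'c::field) \<Rightarrow> 'k fls \<Rightarrow> 'c^'n \<Rightarrow> 'c^'n" where
  "R_scale \<iota> f v = \<iota> f *s v"

definition A_scale :: "('k::finite_field fls \<Rightarrow> 'c::field) \<Rightarrow> 'k poly \<Rightarrow> 'c^'n \<Rightarrow> 'c^'n" where
  "A_scale \<iota> p v = R_scale \<iota> (poly (map_poly fls_const p) fls_X_inv) v"

definition A_rank :: "('k::finite_field fls \<Rightarrow> 'c::field) \<Rightarrow> ('c^'n) set \<Rightarrow> nat \<Rightarrow> bool" where
  "A_rank \<iota> L r \<longleftrightarrow>
     (\<exists>B\<subseteq>L. \<not> module.dependent (A_scale \<iota>) B \<and> finite B \<and> card B = r) \<and>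
     (\<forall>B\<subseteq>L. \<not> module.dependent (A_scale \<iota>) B \<longrightarrow> finite B \<and> card B \<le> r)"

definition uniformizable ::
    "('k::finite_field fls \<Rightarrow> 'c::{field,topological_space}) \<Rightarrow> ('c, 'm::ab_group_add) anderson_module \<Rightarrow>
      ('c^'n^'n) list \<Rightarrow> bool" where
  "uniformizable \<iota> M As \<longleftrightarrow> (\<exists>r. free_of_rank M (act_T M) r \<and> A_rank \<iota> (L_module \<iota> As) r)"

definition is_lattice :: "('k::finite_field fls \<Rightarrow> 'c::field) \<Rightarrow> nat \<Rightarrow> ('c^'n) set \<Rightarrow> bool" where
  "is_lattice \<iota> r L \<longleftrightarrow>
     (\<exists>B. finite B \<and> card B = r \<and> \<not> module.dependent (A_scale \<iota>) B \<and> module.span (A_scale \<iota>) B = L) \<and>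
     vec.span L = UNIV \<and>
     vector_space.dim (R_scale \<iota>) (module.span (R_scale \<iota>) L) = r"

definition lattice_isomorphic :: "('c::field^'n) set \<Rightarrow> ('c^'m) set \<Rightarrow> bool" where
  "lattice_isomorphic L L' \<longleftrightarrow>
     (\<exists>\<phi>. Vector_Spaces.linear (*s) (*s) \<phi> \<and> bij \<phi> \<and> \<phi> ` L = L')"

text \<open>The basis \<open>l\<^sub>1, \<dots>, l\<^sub>r\<close> is split as \<open>l\<close> (the first \<open>n\<close> elements) and \<open>l'\<close> (the last \<open>r - n\<close>).\<close>

definition has_siegel_matrix ::
    "('k::finite_field fls \<Rightarrow> 'c::field) \<Rightarrow> ('c^'n) set \<Rightarrow> 'c^'n^'m \<Rightarrow> bool" where
  "has_siegel_matrix \<iota> L S \<longleftrightarrow>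
     is_lattice \<iota> (CARD('n) + CARD('m)) L \<and>
     (\<exists>(l :: 'n \<Rightarrow> 'c^'n) (l' :: 'm \<Rightarrow> 'c^'n).
        inj (case_sum l l') \<and>
        \<not> module.dependent (A_scale \<iota>) (range (case_sum l l')) \<and>
        module.span (A_scale \<iota>) (range (case_sum l l')) = L \<and>
        vec.independent (range l) \<and> vec.span (range l) = UNIV \<and>
        (\<forall>i. l' i = (\<Sum>j\<in>UNIV. S $ i $ j *s l j)))"

context C_infty
begin

lemma embed_zero: "\<iota> 0 = 0"
  by (metis embed_add add_0 add_cancel_right_right)

lemma embed_minus: "\<iota> (- f) = - \<iota> f"
  using embed_add[of f "- f"] embed_zero by (simp add: eq_neg_iff_add_eq_0 add.commute)

lemma embed_power: "\<iota> (f ^ n) = \<iota> f ^ n"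
  by (induction n) (auto simp: embed_one embed_mult)

lemma embed_eq_0_iff: "\<iota> f = 0 \<longleftrightarrow> f = 0"
proof
  assume "\<iota> f = 0"
  show "f = 0"
  proof (rule ccontr)
    assume "f \<noteq> 0"
    hence "\<iota> f * \<iota> (inverse f) = 1"
      by (simp add: embed_mult[symmetric] embed_one)
    thus False using \<open>\<iota> f = 0\<close> by simp
  qed
qed (simp add: embed_zero)

lemma embed_inj: "\<iota> f = \<iota> g \<longleftrightarrow> f = g"
  using embed_eq_0_iff[of "f - g"] embed_add[of f "- g"] embed_minus[of g] by auto

lemma vector_space_R_scale: "vector_space (R_scale \<iota> :: _ \<Rightarrow> 'c^'n \<Rightarrow> _)"
  by unfold_locales
    (auto simp: R_scale_def embed_add embed_mult embed_one vec_eq_iff algebra_simps)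

lemma module_R_scale: "module (R_scale \<iota> :: _ \<Rightarrow> 'c^'n \<Rightarrow> _)"
  using vector_space_R_scale by (simp add: vector_space_def module_def)

lemma map_poly_fls_const_add:
  "map_poly fls_const (p + q) = map_poly fls_const p + map_poly (fls_const :: 'k \<Rightarrow> _) q"
  by (rule poly_eqI) (simp add: coeff_map_poly fls_plus_const)

lemma map_poly_fls_const_mult:
  "map_poly fls_const (p * q) = map_poly fls_const p * map_poly (fls_const :: 'k \<Rightarrow> _) q"
proof (rule poly_eqI)
  have sum_const: "fls_const (sum h I) = (\<Sum>i\<in>I. fls_const (h i))" for h :: "nat \<Rightarrow> 'k" and I
    by (induction I rule: infinite_finite_induct) (auto simp: fls_plus_const[symmetric])
  show "coeff (map_poly fls_const (p * q)) n =
      coeff (map_poly fls_const p * map_poly (fls_const :: 'k \<Rightarrow> _) q) n" for n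
    by (simp add: coeff_map_poly coeff_mult sum_const fls_const_mult_const)
qed

lemma module_A_scale: "module (A_scale \<iota> :: _ \<Rightarrow> 'c^'n \<Rightarrow> _)"
  by unfold_locales
    (auto simp: A_scale_def R_scale_def embed_add embed_mult embed_one vec_eq_iff algebra_simps
      map_poly_fls_const_add map_poly_fls_const_mult)

lemma poly_at_theta_eq_0_iff:
  "poly (map_poly fls_const p) fls_X_inv = 0 \<longleftrightarrow> p = (0 :: 'k poly)"
proof
  assume *: "poly (map_poly fls_const p) fls_X_inv = 0"
  have deg: "degree (map_poly fls_const p) = degree p"
    by (rule degree_map_poly) auto
  have "fls_nth (poly (map_poly fls_const p) fls_X_inv) (- int n) = coeff p n" for n
  proof -
    have "fls_nth (poly (map_poly fls_const p) fls_X_inv) (- int n) =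
        (\<Sum>i\<le>degree p. coeff p i * (if i = n then 1 else 0))"
      by (simp add: poly_altdef deg coeff_map_poly fls_nth_sum fls_X_inv_power_nth
          cong: if_cong) (rule sum.cong, auto)
    also have "\<dots> = coeff p n"
      by (auto simp: if_distrib[of "(*) _"] coeff_eq_0 cong: if_cong)
    finally show ?thesis .
  qed
  thus "p = 0" using * by (intro poly_eqI) (metis coeff_0 fls_zero_nth)
qed simp

lemma A_independent_if_R_independent:
  assumes "\<not> module.dependent (R_scale \<iota>) (B :: ('c^'n) set)"
  shows "\<not> module.dependent (A_scale \<iota>) B"
proof
  assume "module.dependent (A_scale \<iota>) B"
  then obtain t u where t: "finite t" "t \<subseteq> B" "(\<Sum>v\<in>t. A_scale \<iota> (u v) v) = 0" "\<exists>v\<in>t. u v \<noteq> 0"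
    by (auto simp: module.dependent_explicit[OF module_A_scale])
  hence "module.dependent (R_scale \<iota>) B"
    unfolding module.dependent_explicit[OF module_R_scale]
    by (intro exI[of _ t] exI[of _ "\<lambda>v. poly (map_poly fls_const (u v)) fls_X_inv"])
       (auto simp: A_scale_def poly_at_theta_eq_0_iff)
  with assms show False by simp
qed

lemma F_q2_not_embed:
  assumes "\<omega> \<in> F_q2 \<iota> - F_q \<iota>"
  shows "\<omega> \<noteq> \<iota> f"
proof
  assume eq: "\<omega> = \<iota> f"
  define q where "q = CARD('k)"
  have q: "q \<ge> 2"
    using card_mono[of UNIV "{0, 1 :: 'k}"] by (simp add: q_def)
  have f: "f ^ (q\<^sup>2) = f"
    using assms eq by (simp add: F_q2_def q_def embed_power[symmetric] embed_inj)
  have q1: "q\<^sup>2 > 1" using q by (simp add: power2_eq_square one_less_mult)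
  have sub: "g = 0 \<or> fls_subdegree g = 0" if "g ^ (q\<^sup>2) = g" for g :: "'k fls"
  proof -
    have "int (q\<^sup>2) * fls_subdegree g = fls_subdegree g"
      using fls_subdegree_pow[of g "q\<^sup>2"] that by simp
    hence "(int (q\<^sup>2) - 1) * fls_subdegree g = 0" by (simp add: algebra_simps)
    moreover have "int (q\<^sup>2) - 1 \<noteq> 0" using q1 by linarith
    ultimately show ?thesis by simp
  qed
  have "fls_subdegree f \<ge> 0" using sub[OF f] by auto
  then obtain g where g: "f = fps_to_fls g"
    by (metis fls_as_fps' of_nat_0_le_iff fls_regpart_to_fls_trivial)
  have gq: "g ^ (q\<^sup>2) = g"
    using f by (simp add: g fps_to_fls_power[symmetric])
  have "(of_nat q :: 'k) = 0"
  proof -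
    have "(\<Sum>x\<in>UNIV. x :: 'k) = (\<Sum>x\<in>UNIV. x + 1)"
      by (rule sum.reindex_bij_witness[of _ "\<lambda>x. x + 1" "\<lambda>x. x - 1"]) auto
    thus ?thesis by (simp add: sum.distrib q_def)
  qed
  hence q0: "(of_nat (q\<^sup>2) :: 'k) = 0" by simp
  define c where "c = fps_nth g 0"
  have c: "fps_const c ^ (q\<^sup>2) = fps_const c"
    by (simp add: fps_const_power finite_field_power_card_power_eq_same[of _ 2] q_def)
  define S where "S = (\<Sum>i<q\<^sup>2. fps_const c ^ (q\<^sup>2 - Suc i) * g ^ i)"
  have "g - fps_const c = (g - fps_const c) * S"
    using power_diff_sumr2[of g "q\<^sup>2" "fps_const c"] unfolding gq c S_def .
  moreover have "fps_nth S 0 = 0"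
  proof -
    have "fps_nth S 0 = (\<Sum>i<q\<^sup>2. c ^ (q\<^sup>2 - Suc i) * c ^ i)"
      by (simp add: S_def fps_sum_nth fps_nth_power_0 c_def)
    also have "\<dots> = (\<Sum>i<q\<^sup>2. c ^ (q\<^sup>2 - 1))"
      by (intro sum.cong) (auto simp: power_add[symmetric])
    also have "\<dots> = 0" using q0 by simp
    finally show ?thesis .
  qed
  hence "S \<noteq> 1" by auto
  ultimately have "g = fps_const c" by simp
  hence "f = fls_const c" by (simp add: g)
  thus False using assms eq by (auto simp: F_q_def)
qed

lemma has_siegel_matrix_exists:
  assumes "\<omega> \<in> F_q2 \<iota> - F_q \<iota>"
  shows "\<exists>L. has_siegel_matrix \<iota> L (vector [vector [s, \<omega>]] :: 'c^2^1)"
proof -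
  interpret R: vector_space "R_scale \<iota> :: _ \<Rightarrow> 'c^2 \<Rightarrow> _" by (rule vector_space_R_scale)
  interpret A: module "A_scale \<iota> :: _ \<Rightarrow> 'c^2 \<Rightarrow> _" by (rule module_A_scale)
  define x y z :: "'c^2" where "x = vector [1, 0]" and "y = vector [0, 1]" and "z = vector [s, \<omega>]"
  define B where "B = {x, y, z}"
  have \<omega>: "\<omega> \<noteq> 0" "\<omega> \<noteq> 1" "\<omega> \<noteq> \<iota> f" for f
    using F_q2_not_embed[OF assms] embed_zero embed_one by metis+
  have neq: "x \<noteq> y" "x \<noteq> z" "y \<noteq> z"
    using \<omega> by (auto simp: x_def y_def z_def vec_eq_iff forall_2)
  have lin: "a = 0 \<and> b = 0 \<and> c = 0"
    if "R_scale \<iota> a x + R_scale \<iota> b y + R_scale \<iota> c z = 0" for a b c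
  proof -
    have 1: "\<iota> a + \<iota> c * s = 0" and 2: "\<iota> b + \<iota> c * \<omega> = 0"
      using that by (auto simp: R_scale_def x_def y_def z_def vec_eq_iff forall_2)
    have "c = 0"
    proof (rule ccontr)
      assume c: "c \<noteq> 0"
      have "\<iota> c * \<omega> = \<iota> c * \<iota> (- b / c)"
        using 2 c by (simp add: embed_mult[symmetric] embed_minus eq_neg_iff_add_eq_0 add.commute)
      thus False using c \<omega>(3) by (simp add: embed_eq_0_iff)
    qed
    thus ?thesis using 1 2 by (simp add: embed_eq_0_iff embed_zero)
  qed
  have R_ind: "R.independent B"
    unfolding B_def
  proof
    assume "R.dependent {x, y, z}"
    then obtain u v where *: "(\<Sum>v\<in>{x, y, z}. R_scale \<iota> (u v) v) = 0"
        and nz: "u v \<noteq> 0" "v \<in> {x, y, z}"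
      by (auto simp: R.dependent_finite)
    have "u x = 0 \<and> u y = 0 \<and> u z = 0"
      by (rule lin) (use * neq in \<open>simp add: add.assoc\<close>)
    with nz show False by auto
  qed
  have A_ind: "\<not> A.dependent B"
    by (rule A_independent_if_R_independent[OF R_ind])
  have card: "card B = 3" using neq by (simp add: B_def)
  define L where "L = A.span B"
  have BL: "B \<subseteq> L" by (simp add: L_def A.span_superset)
  have xy: "v = v $ 1 *s x + v $ 2 *s y" for v
    by (simp add: vec_eq_iff forall_2 x_def y_def)
  have span_xy: "vec.span {x, y} = UNIV"
  proof -
    have "v \<in> vec.span {x, y}" for v
      by (subst xy[of v]) (intro vec.span_add vec.span_scale vec.span_base; simp)
    thus ?thesis by auto
  qed
  have spanL: "vec.span L = UNIV"
    using span_xy vec.span_mono[of "{x, y}" L] BL by (auto simp: B_def)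
  have "L \<subseteq> R.span B"
  proof
    fix v assume "v \<in> L"
    then obtain t r where "finite t" "t \<subseteq> B" "v = (\<Sum>a\<in>t. A_scale \<iota> (r a) a)"
      by (auto simp: L_def A.span_explicit)
    thus "v \<in> R.span B"
      by (simp add: A_scale_def) (intro R.span_sum R.span_scale, auto intro: R.span_base)
  qed
  hence "R.span L = R.span B"
    by (metis BL R.span_mono R.span_span subset_antisym)
  hence dim: "R.dim (R.span L) = 3"
    using R.dim_eq_card_independent[OF R_ind] card by (simp add: R.dim_span)
  have lattice: "is_lattice \<iota> 3 L"
    unfolding is_lattice_def
    using A_ind card spanL dim by (auto simp: L_def B_def intro!: exI[of _ "{x, y, z}"])
  define l :: "2 \<Rightarrow> 'c^2" where "l = (\<lambda>i. if i = 1 then x else y)"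
  define l' :: "1 \<Rightarrow> 'c^2" where "l' = (\<lambda>_. z)"
  have range_l: "range l = {x, y}"
    by (auto simp: l_def UNIV_2)
  have range: "range (case_sum l l') = B"
    using range_l by (simp add: UNIV_sum image_Un image_image l'_def B_def) blast
  have inj: "inj (case_sum l l')"
    by (rule eq_card_imp_inj_on) (auto simp: range card)
  have ind: "vec.independent (range l)"
    unfolding range_l
    by (rule vec.card_le_dim_spanning[of _ UNIV]) (use span_xy neq in \<open>auto simp: vec.dim_UNIV card_cart_basis\<close>)
  have "l' i = (\<Sum>j\<in>UNIV. (vector [vector [s, \<omega>]] :: 'c^2^1) $ i $ j *s l j)" for i
  proof -
    have "(vector [vector [s, \<omega>]] :: 'c^2^1) $ i = vector [s, \<omega>]"
      using num1_eq1[of i] vector_1 by metis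
    thus ?thesis
      by (simp add: l'_def l_def sum_2) (subst xy, simp add: z_def)
  qed
  hence "has_siegel_matrix \<iota> L (vector [vector [s, \<omega>]] :: 'c^2^1)"
    unfolding has_siegel_matrix_def
    using lattice inj A_ind ind span_xy
    by (intro conjI exI[of _ l] exI[of _ l']) (auto simp: range range_l L_def)
  thus ?thesis by blast
qed

end

end

theory Submission
  imports Defs
begin

text \<open>
  Take \<open>a\<^sub>1\<^sub>1 = a\<^sub>1\<^sub>2 = 0\<close> and \<open>a\<^sub>2\<^sub>1 = a\<close>. Then the t-module is an extension of the Carlitz module of
  \<open>\<bbbF>\<^bsub>q\<^sup>2\<^esub>[\<theta>]\<close> by the Carlitz module of \<open>\<bbbF>\<^bsub>q\<^esub>[\<theta>]\<close>, and its exponential is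
  \<open>(z\<^sub>1, z\<^sub>2) \<mapsto> (e\<^sub>2 z\<^sub>1, e\<^sub>1 z\<^sub>2 + g\<^sub>a z\<^sub>1)\<close> with the two Carlitz exponentials and an entire additive \<open>g\<^sub>a\<close>.
  With the Carlitz periods \<open>\<pi>\<^sub>1\<close>, \<open>\<pi>\<^sub>2\<close> its kernel has the basis \<open>(0, \<pi>\<^sub>1)\<close>, \<open>(\<pi>\<^sub>2, x)\<close>, \<open>(\<omega>\<pi>\<^sub>2, y)\<close>,
  where \<open>e\<^sub>1 x = - g\<^sub>a \<pi>\<^sub>2\<close> and \<open>e\<^sub>1 y = - g\<^sub>a (\<omega>\<pi>\<^sub>2)\<close>, so its Siegel matrix is \<open>((y - \<omega>x) / \<pi>\<^sub>1, \<omega>)\<close>.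
  The map \<open>a \<mapsto> y - \<omega>x\<close>, with the small logarithms, is additive, and its linear coefficient is
  \<open>(\<omega> - \<omega>\<^sup>q) h(\<pi>\<^sub>2)\<close> for an explicit series \<open>h\<close>. The first term of \<open>h(\<pi>\<^sub>2)\<close> dominates the others, so
  the coefficient is nonzero and Banach's fixed point theorem yields every small \<open>s\<^sub>1\<^sub>1\<close>.
\<close>

no_notation fps_nth (infixl "$" 75)

text \<open>At \<open>a = 0\<close> the kernel is the direct sum of two Carlitz lattices and has
  Siegel matrix (0, \<omega>), so the claim is a local inversion around this point. The dependence
  on \<open>a\<close> is not linear: the coefficients of g_a contain \<open>a\<close>, its q-th
  power and so on, and additivity is the structure that survives. An additive map that equals c a up
  to an error of order |a|^2 can be inverted near 0 as soon as c is nonzero, so everything rests on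
  c. To first order \<open>a\<close> enters through the quasi-periods, the values of
  \<open>quasi\<close> at periods. These satisfy
  \<open>quasi (\<omega> * z) = \<omega> ^ q * quasi z\<close>, while the Siegel entry combines them
  as y - \<omega> x; this is where \<omega> - \<omega>^q comes from, and it is nonzero because
  \<omega> lies outside F_q. That the first term of the series dominates at
  \<open>\<pi>\<^sub>2\<close> depends on the size of the period, 1 < |\<open>\<pi>\<^sub>2\<close>
  / \<theta>| \<le> q, which is why the period is constructed together with these bounds.\<close>

locale C_infty_card = C_infty \<iota>
  for \<iota> :: "'k::finite_field fls \<Rightarrow> 'c::{alg_closed_field,complete_space}" +
  fixes q :: nat
  assumes card_k: "q = CARD('k)"
begin

abbreviation \<theta> :: 'c where "\<theta> \<equiv> theta \<iota>"

section \<open>Frobenius powers are additive\<close>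

lemma q_ge_2: "q \<ge> 2"
  using card_mono[of UNIV "{0, 1 :: 'k}"] by (simp add: card_k)

lemma q_pos [simp]: "q > 0" "q \<noteq> 0"
  using q_ge_2 by auto

text \<open>Every x in the field with \<open>q\<close> elements satisfies x^q = x, so the middle
  part of the binomial expansion of (x + 1)^q vanishes at all \<open>q\<close> elements. Its degree
  is below \<open>q\<close>, hence it is the zero polynomial. In this way \<open>q\<close> never has
  to be written as a prime power.\<close>

lemma of_nat_q_choose_eq_0:
  assumes "0 < i" "i < q"
  shows "of_nat (q choose i) = (0 :: 'c)"
proof -
  define f :: "'k poly" where "f = (\<Sum>i\<in>{1..<q}. monom (of_nat (q choose i)) i)"
  have root: "poly f x = 0" for x
  proof -
    have "(x + 1) ^ q = (\<Sum>i\<le>q. of_nat (q choose i) * x ^ i)"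
      by (simp add: binomial_ring)
    also have "{..q} = insert 0 (insert q {1..<q})" by auto
    also have "(\<Sum>i\<in>\<dots>. of_nat (q choose i) * x ^ i) = 1 + x ^ q + poly f x"
      by (simp add: f_def poly_sum poly_monom add_ac)
    finally show ?thesis by (simp add: finite_field_power_card_eq_same card_k)
  qed
  have "f = 0"
  proof (rule ccontr)
    assume "f \<noteq> 0"
    hence "q \<le> degree f"
      using card_poly_roots_bound[of f] root by (simp add: card_k)
    moreover have "degree f \<le> q - 1"
      unfolding f_def by (intro degree_sum_le) (auto intro: order.trans[OF degree_monom_le])
    ultimately show False using q_ge_2 by linarith
  qed
  moreover have "coeff f i = of_nat (q choose i)"
    using assms by (simp add: f_def coeff_sum)
  ultimately have "of_nat (q choose i) = (0 :: 'k)" by simp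
  moreover have "\<iota> (of_nat n) = of_nat n" for n
    by (induction n) (auto simp: embed_zero embed_add embed_one)
  moreover have "(of_nat n :: 'k fls) = fls_const (of_nat n)" for n
    by (simp add: fls_of_nat)
  ultimately show ?thesis using embed_zero by (metis fls_const_0)
qed

lemma add_power_q: "(x + y :: 'c) ^ q = x ^ q + y ^ q"
proof -
  have "(x + y) ^ q = (\<Sum>i\<le>q. of_nat (q choose i) * x ^ i * y ^ (q - i))"
    by (rule binomial_ring)
  also have "\<dots> = (\<Sum>i\<in>{0, q}. of_nat (q choose i) * x ^ i * y ^ (q - i))"
    by (rule sum.mono_neutral_right) (auto simp: of_nat_q_choose_eq_0)
  finally show ?thesis by (simp add: add.commute)
qed

lemma add_power_q_power: "(x + y :: 'c) ^ (q ^ n) = x ^ (q ^ n) + y ^ (q ^ n)"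
  by (induction n) (simp_all add: power_mult mult.commute[of q] add_power_q)

lemma minus_power_q_power: "(- x :: 'c) ^ (q ^ n) = - (x ^ (q ^ n))"
  using add_power_q_power[of x "- x" n] by (simp add: eq_neg_iff_add_eq_0 add.commute zero_power)

lemma diff_power_q_power: "(x - y :: 'c) ^ (q ^ n) = x ^ (q ^ n) - y ^ (q ^ n)"
  using add_power_q_power[of x "- y" n] by (simp add: minus_power_q_power)

lemma sum_power_q_power: "sum f I ^ (q ^ n) = (\<Sum>i\<in>I. (f i :: 'c) ^ (q ^ n))"
  by (induction I rule: infinite_finite_induct) (auto simp: add_power_q_power zero_power)

section \<open>The non-archimedean absolute value\<close>

lemma absval_nonneg [simp]: "absval (x :: 'c) \<ge> 0"
  by (simp add: absval_def)

lemma absval_zero [simp]: "absval (0 :: 'c) = 0"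
  by (simp add: absval_def)

lemma absval_eq_0_iff [simp]: "absval (x :: 'c) = 0 \<longleftrightarrow> x = 0"
  by (simp add: absval_def)

lemma absval_pos_iff [simp]: "absval (x :: 'c) > 0 \<longleftrightarrow> x \<noteq> 0"
  by (simp add: absval_def)

lemma absval_one [simp]: "absval (1 :: 'c) = 1"
proof -
  have "absval (1 :: 'c) * absval (1 :: 'c) = absval (1 :: 'c)"
    by (simp flip: absval_mult)
  thus ?thesis by (simp del: absval_eq_0_iff add: absval_def)
qed

lemma absval_power: "absval (x ^ n :: 'c) = absval x ^ n"
  by (induction n) (auto simp: absval_mult)

lemma absval_minus [simp]: "absval (- x :: 'c) = absval x"
  by (metis absval_def dist_absval dist_commute diff_0_right diff_0)

lemma absval_divide: "absval (x / y :: 'c) = absval x / absval y"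
proof (cases "y = 0")
  case False
  hence "absval (x / y) * absval y = absval x"
    by (simp flip: absval_mult)
  thus ?thesis using False by (simp add: field_simps)
qed simp

lemma absval_diff: "absval (x - y :: 'c) \<le> max (absval x) (absval y)"
  using absval_add[of x "- y"] by simp

lemma absval_add_eq:
  assumes "absval (y :: 'c) < absval x"
  shows "absval (x + y) = absval x"
  using absval_add[of x y] absval_diff[of "x + y" y] assms by simp

lemma absval_sum_le:
  assumes "\<And>i. i \<in> I \<Longrightarrow> absval (f i :: 'c) \<le> B" "B \<ge> 0"
  shows "absval (sum f I) \<le> B"
  using assms
proof (induction I rule: infinite_finite_induct)
  case (insert i I)
  have "absval (f i) \<le> B" "absval (sum f I) \<le> B" using insert by auto
  thus ?case using absval_add[of "f i" "sum f I"] insert.hyps by simp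
qed auto

lemma absval_theta: "absval \<theta> = real q"
  unfolding theta_def by (subst absval_embed) (auto simp: card_k)

lemma theta_nonzero [simp]: "\<theta> \<noteq> 0"
  using absval_theta by (auto simp flip: absval_pos_iff)

lemma absval_theta_power_diff:
  assumes "i > 0"
  shows "absval (\<theta> ^ (q ^ i) - \<theta>) = real q ^ (q ^ i)"
proof -
  have "q ^ i \<ge> q ^ 1" using assms q_ge_2 by (intro power_increasing) auto
  hence "real q ^ (q ^ i) > real q ^ 1"
    using q_ge_2 by (intro power_strict_increasing) auto
  thus ?thesis
    using absval_add_eq[of "- \<theta>" "\<theta> ^ (q ^ i)"] by (simp add: absval_power absval_theta)
qed

lemma theta_power_diff_nonzero: "i > 0 \<Longrightarrow> \<theta> ^ (q ^ i) - \<theta> \<noteq> 0"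
  using absval_theta_power_diff[of i] by (auto simp flip: absval_pos_iff)

section \<open>Limits and series over the complete field\<close>

lemma tendsto_iff_absval:
  "(f \<longlongrightarrow> (l :: 'c)) F \<longleftrightarrow> ((\<lambda>x. absval (f x - l)) \<longlongrightarrow> 0) F"
  by (subst tendsto_dist_iff) (simp add: dist_absval)

lemma tendsto_add_field:
  assumes "(f \<longlongrightarrow> (l :: 'c)) F" "(g \<longlongrightarrow> m) F"
  shows "((\<lambda>x. f x + g x) \<longlongrightarrow> l + m) F"
proof -
  have lim: "((\<lambda>x. absval (f x - l) + absval (g x - m)) \<longlongrightarrow> 0) F"
    using assms[unfolded tendsto_iff_absval] by (rule tendsto_add_zero)
  have le: "absval (f x + g x - (l + m)) \<le> absval (f x - l) + absval (g x - m)" for x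
  proof -
    have "absval (f x + g x - (l + m)) \<le> max (absval (f x - l)) (absval (g x - m))"
      using absval_add[of "f x - l" "g x - m"] by (simp only: add_diff_add)
    also have "\<dots> \<le> absval (f x - l) + absval (g x - m)"
      by (rule max.boundedI) auto
    finally show ?thesis .
  qed
  show ?thesis
    unfolding tendsto_iff_absval
    by (rule tendsto_sandwich[OF _ _ tendsto_const lim]) (auto intro!: always_eventually le)
qed

lemma tendsto_mult_left_field:
  assumes "(f \<longlongrightarrow> (l :: 'c)) F"
  shows "((\<lambda>x. c * f x) \<longlongrightarrow> c * l) F"
proof -
  have "((\<lambda>x. absval c * absval (f x - l)) \<longlongrightarrow> 0) F"
    using assms[unfolded tendsto_iff_absval] by (rule tendsto_mult_right_zero)
  thus ?thesis
    unfolding tendsto_iff_absval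
    by (simp flip: absval_mult add: algebra_simps)
qed

lemma tendsto_power_q_power:
  assumes "(f \<longlongrightarrow> (l :: 'c)) F"
  shows "((\<lambda>x. f x ^ (q ^ n)) \<longlongrightarrow> l ^ (q ^ n)) F"
proof -
  have "((\<lambda>x. absval (f x - l) ^ (q ^ n)) \<longlongrightarrow> 0 ^ (q ^ n)) F"
    using assms[unfolded tendsto_iff_absval] by (rule tendsto_power)
  thus ?thesis
    unfolding tendsto_iff_absval
    by (simp add: diff_power_q_power[symmetric] absval_power zero_power)
qed

lemma sums_add_field:
  assumes "f sums (a :: 'c)" "g sums b"
  shows "(\<lambda>i. f i + g i) sums (a + b)"
  using assms unfolding sums_def by (simp add: sum.distrib tendsto_add_field)

lemma sums_mult_field:
  assumes "f sums (a :: 'c)"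
  shows "(\<lambda>i. c * f i) sums (c * a)"
  using assms unfolding sums_def by (simp add: sum_distrib_left[symmetric] tendsto_mult_left_field)

lemma sums_diff_field:
  assumes "f sums (a :: 'c)" "g sums b"
  shows "(\<lambda>i. f i - g i) sums (a - b)"
  using sums_add_field[OF assms(1) sums_mult_field[OF assms(2), of "- 1"]] by simp

lemma sums_power_q_power:
  assumes "f sums (a :: 'c)"
  shows "(\<lambda>i. f i ^ (q ^ n)) sums (a ^ (q ^ n))"
  using assms unfolding sums_def by (simp add: sum_power_q_power[symmetric] tendsto_power_q_power)

lemma sums_shift_field:
  assumes "f sums (a :: 'c)"
  shows "(\<lambda>i. if i < k then 0 else f (i - k)) sums a"
proof -
  have "(\<Sum>i<n + k. if i < k then 0 else f (i - k)) = (\<Sum>i<n. f i)" for n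
    by (induction n) simp_all
  hence "(\<lambda>n. \<Sum>i<n + k. if i < k then 0 else f (i - k)) \<longlonglongrightarrow> a"
    using assms by (simp add: sums_def)
  thus ?thesis
    unfolding sums_def by (rule LIMSEQ_offset)
qed

text \<open>The ultrametric inequality loses nothing under summation, so series are estimated term
  by term from here on.\<close>

lemma sums_bound_field:
  assumes "f sums (a :: 'c)" "\<And>i. absval (f i) \<le> B"
  shows "absval a \<le> B"
proof -
  have B: "B \<ge> 0" using assms(2)[of 0] absval_nonneg order.trans by blast
  have "(\<lambda>n. \<Sum>i<n. f i) \<longlonglongrightarrow> a" using assms(1) by (simp add: sums_def)
  hence "(\<lambda>n. dist (\<Sum>i<n. f i) 0) \<longlonglongrightarrow> dist a 0"
    by (intro tendsto_intros)
  moreover have "dist (\<Sum>i<n. f i) 0 \<le> B" for n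
    using absval_sum_le[of "{..<n}" f B] assms(2) B by (simp add: absval_def)
  ultimately show ?thesis
    unfolding absval_def by (intro LIMSEQ_le_const2) auto
qed

text \<open>A difference of partial sums is at most its largest term, so terms tending to 0 already
  give a Cauchy sequence.\<close>

lemma summable_field:
  assumes "(\<lambda>i. absval (f i :: 'c)) \<longlonglongrightarrow> 0"
  shows "summable f"
proof -
  have "Cauchy (\<lambda>n. \<Sum>i<n. f i)"
  proof (rule metric_CauchyI)
    fix e :: real assume e: "e > 0"
    then obtain N where N: "\<And>i. i \<ge> N \<Longrightarrow> absval (f i) < e / 2"
      using LIMSEQ_D[OF assms, of "e / 2"] by auto
    have *: "dist (\<Sum>i<m. f i) (\<Sum>i<n. f i) < e" if "N \<le> n" "n \<le> m" for m n
    proof -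
      have "(\<Sum>i<m. f i) - (\<Sum>i<n. f i) = (\<Sum>i\<in>{n..<m}. f i)"
        using that sum_diff_nat_ivl[of 0 n m f] by (simp add: atLeast0LessThan)
      moreover have "absval (\<Sum>i\<in>{n..<m}. f i) \<le> e / 2"
      proof (rule absval_sum_le)
        fix i assume "i \<in> {n..<m}"
        thus "absval (f i) \<le> e / 2" using N[of i] that by simp
      qed (use e in simp)
      ultimately have "dist (\<Sum>i<m. f i) (\<Sum>i<n. f i) \<le> e / 2"
        by (simp add: dist_absval)
      thus ?thesis using e by linarith
    qed
    show "\<exists>N. \<forall>m\<ge>N. \<forall>n\<ge>N. dist (\<Sum>i<m. f i) (\<Sum>i<n. f i) < e"
      using * by (metis dist_commute nle_le)
  qed
  thus ?thesis
    by (simp add: summable_iff_convergent Cauchy_convergent)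
qed

text \<open>The solution is the fixed point of z \<mapsto> w - N z on the closed ball of radius r;
  additivity turns the bound on |N x| into a Lipschitz bound. Additivity is asked for on the ball
  only, because the \<open>N\<close> of the Siegel entry is built from logarithms near 0.\<close>

lemma additive_contraction_solvable:
  fixes N :: "'c \<Rightarrow> 'c"
  assumes \<kappa>: "0 \<le> \<kappa>" "\<kappa> < 1"
    and diff: "\<And>x y. absval x \<le> r \<Longrightarrow> absval y \<le> r \<Longrightarrow> N (x - y) = N x - N y"
    and le: "\<And>x. absval x \<le> r \<Longrightarrow> absval (N x) \<le> \<kappa> * absval x"
    and w: "absval w \<le> r"
  shows "\<exists>z. absval z \<le> r \<and> z + N z = w"
proof -
  define S where "S = cball (0 :: 'c) r"
  have S: "x \<in> S \<longleftrightarrow> absval x \<le> r" for x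
    by (simp add: S_def absval_def dist_commute)
  have N_le: "absval (N x) \<le> absval x" if "absval x \<le> r" for x
    using le[OF that] \<kappa> mult_right_mono[of \<kappa> 1 "absval x"] by simp
  have "\<exists>!z\<in>S. w - N z = z"
  proof (rule Banach_fix[OF _ _ \<kappa>])
    show "complete S" by (simp add: S_def complete_eq_closed)
    show "S \<noteq> {}" using w S by blast
    show "(\<lambda>z. w - N z) ` S \<subseteq> S"
    proof clarify
      fix z assume "z \<in> S"
      thus "w - N z \<in> S" using absval_diff[of w "N z"] N_le[of z] w by (simp add: S)
    qed
    fix x y assume "x \<in> S" "y \<in> S"
    hence xy: "absval x \<le> r" "absval y \<le> r" by (simp_all add: S)
    have "dist (w - N x) (w - N y) = absval (N (x - y))"
      using diff[OF xy] absval_minus[of "N x - N y"] by (simp add: dist_absval)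
    also have "\<dots> \<le> \<kappa> * absval (x - y)"
      using absval_diff[of x y] xy by (intro le) linarith
    finally show "dist (w - N x) (w - N y) \<le> \<kappa> * dist x y" by (simp add: dist_absval)
  qed
  then obtain z where "z \<in> S" "w - N z = z" by blast
  thus ?thesis using S by (intro exI[of _ z]) (simp add: algebra_simps)
qed

subsection \<open>Additive power series\<close>

definition qsum :: "(nat \<Rightarrow> 'c) \<Rightarrow> 'c \<Rightarrow> 'c" where
  "qsum u z = (\<Sum>i. u i * z ^ (q ^ i))"

text \<open>This is q^(-i/2), the exact value of |u i|^(1/q^i) at even i for the quadratic Carlitz
  exponential, where each step by 2 contributes a factor 1/q. All other coefficient sequences below
  satisfy the same bound.\<close>

definition rate :: "nat \<Rightarrow> real" where
  "rate i = (1 / sqrt (real q)) ^ i"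

text \<open>The factor \<open>K\<close> records the dependence on the extension parameter: it will
  be |a| for \<open>ext_coeff a\<close> and |a|^2 for the nonlinear part of it.\<close>

definition qbound :: "real \<Rightarrow> (nat \<Rightarrow> 'c) \<Rightarrow> bool" where
  "qbound K u \<longleftrightarrow> (\<forall>i. absval (u i) \<le> K * rate i ^ (q ^ i))"

lemma rate_pos [simp]: "rate i > 0"
  by (simp add: rate_def)

lemma rate_nonneg [simp]: "rate i \<ge> 0"
  using rate_pos less_imp_le by blast

lemma rate_le_1: "rate i \<le> 1"
proof -
  have "1 / sqrt (real q) \<le> 1" using q_ge_2 by simp
  thus ?thesis unfolding rate_def by (intro power_le_one) auto
qed

lemma rate_antimono: "i \<le> j \<Longrightarrow> rate j \<le> rate i"
  unfolding rate_def by (rule power_decreasing) (use q_ge_2 in auto)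

lemma rate_Suc_Suc: "rate (Suc (Suc i)) = rate i / q"
  by (simp add: rate_def)

lemma rate_tendsto_0: "rate \<longlonglongrightarrow> 0"
proof -
  have "1 < sqrt (real q)" using q_ge_2 by (simp add: real_less_rsqrt)
  thus ?thesis unfolding rate_def by (intro LIMSEQ_power_zero) auto
qed

lemma rate_power_tendsto_0:
  assumes "x \<ge> 0"
  shows "(\<lambda>i. (rate i * x) ^ (q ^ i)) \<longlonglongrightarrow> 0"
proof -
  have lim: "(\<lambda>i. rate i * x) \<longlonglongrightarrow> 0"
    using tendsto_mult_right[OF rate_tendsto_0, of x] by simp
  have "eventually (\<lambda>i. rate i * x < 1) sequentially"
    by (rule order_tendstoD(2)[OF lim]) simp
  hence "eventually (\<lambda>i. (rate i * x) ^ (q ^ i) \<le> rate i * x) sequentially"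
  proof eventually_elim
    case (elim i)
    have "(rate i * x) ^ (q ^ i) \<le> (rate i * x) ^ 1"
      using elim assms q_ge_2 by (intro power_decreasing) auto
    thus ?case by simp
  qed
  thus ?thesis
    by (rule tendsto_sandwich[OF _ _ tendsto_const lim, rotated]) (use assms in simp)
qed

lemma qsum_sums:
  assumes "qbound K u"
  shows "(\<lambda>i. u i * z ^ (q ^ i)) sums qsum u z"
proof -
  have lim: "(\<lambda>i. K * (rate i * absval z) ^ (q ^ i)) \<longlonglongrightarrow> 0"
    using tendsto_mult_left[OF rate_power_tendsto_0[of "absval z"], of K] by simp
  have le: "absval (u i * z ^ (q ^ i)) \<le> K * (rate i * absval z) ^ (q ^ i)" for i
    using mult_right_mono[of "absval (u i)" "K * rate i ^ (q ^ i)" "absval z ^ (q ^ i)"] assms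
    by (simp add: qbound_def absval_mult absval_power power_mult_distrib mult_ac)
  have "(\<lambda>i. absval (u i * z ^ (q ^ i))) \<longlonglongrightarrow> 0"
    by (rule tendsto_sandwich[OF _ _ tendsto_const lim]) (auto intro!: always_eventually le)
  thus ?thesis
    unfolding qsum_def by (intro summable_sums summable_field)
qed

text \<open>The constant depends on z but not on u. This uniformity yields estimates in |a| and
  |a|^2 at a fixed period.\<close>

lemma qsum_bound: "\<exists>B>0. \<forall>K u. K \<ge> 0 \<longrightarrow> qbound K u \<longrightarrow> absval (qsum u z) \<le> K * B"
proof -
  obtain B where B: "B > 0" "\<And>i. \<bar>(rate i * absval z) ^ (q ^ i)\<bar> \<le> B"
    using convergent_imp_Bseq[OF convergentI[OF rate_power_tendsto_0[of "absval z"]]]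
    by (auto elim: BseqE)
  have "absval (qsum u z) \<le> K * B" if K: "K \<ge> 0" and u: "qbound K u" for K u
  proof (rule sums_bound_field[OF qsum_sums[OF u]])
    fix i
    have "absval (u i * z ^ (q ^ i)) \<le> K * rate i ^ (q ^ i) * absval z ^ (q ^ i)"
      using u by (simp add: qbound_def absval_mult absval_power mult_right_mono)
    also have "\<dots> = K * (rate i * absval z) ^ (q ^ i)"
      by (simp add: power_mult_distrib)
    also have "\<dots> \<le> K * B"
      using B(2)[of i] K by (intro mult_left_mono) auto
    finally show "absval (u i * z ^ (q ^ i)) \<le> K * B" .
  qed
  thus ?thesis using B(1) by blast
qed

text \<open>Convergence at 1 bounds all coefficients by some B. If u m is the first nonzero one,
  evaluation at \<theta>^(-n), of absolute value \<epsilon> = q^(-n), bounds the m-th term by the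
  tail, so |u m| \<le> B \<epsilon> for every n.\<close>

lemma qseries_identity:
  assumes "\<And>z. (\<lambda>i. u i * z ^ (q ^ i)) sums (0 :: 'c)"
  shows "u n = 0"
proof (rule ccontr)
  assume "u n \<noteq> 0"
  define m where "m = (LEAST m. u m \<noteq> 0)"
  have m: "u m \<noteq> 0" "\<And>i. i < m \<Longrightarrow> u i = 0"
    using \<open>u n \<noteq> 0\<close> unfolding m_def by (metis (mono_tags) LeastI, metis (mono_tags) not_less_Least)
  have "(\<lambda>n. \<Sum>i<n. u i) \<longlonglongrightarrow> 0"
    using assms[of 1] by (simp add: sums_def)
  hence "(\<lambda>n. dist (\<Sum>i<n. u i) 0) \<longlonglongrightarrow> dist (0 :: 'c) 0"
    by (intro tendsto_intros)
  from convergent_imp_Bseq[OF convergentI[OF this]]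
  obtain B where B: "B > 0" "\<And>n. absval (\<Sum>i<n. u i) \<le> B"
    unfolding absval_def by (auto elim: BseqE)
  have uB: "absval (u i) \<le> B" for i
    using absval_diff[of "\<Sum>j<Suc i. u j" "\<Sum>j<i. u j"] B(2)[of i] B(2)[of "Suc i"] by simp
  have small: "absval (u m) \<le> B * (1 / real q) ^ n" for n
  proof -
    define z where "z = \<iota> (fls_X ^ n)"
    define \<epsilon> where "\<epsilon> = (1 / real q) ^ n"
    have z: "absval z = \<epsilon>"
      unfolding z_def \<epsilon>_def
      by (subst absval_embed) (auto simp: card_k powr_minus powr_realpow field_simps)
    have \<epsilon>: "0 < \<epsilon>" "\<epsilon> \<le> 1" unfolding \<epsilon>_def using q_ge_2 by (auto intro: power_le_one)
    have "(\<lambda>i. (if i = m then u m * z ^ (q ^ m) else 0)) sums (u m * z ^ (q ^ m))"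
      by (rule sums_single)
    from sums_diff_field[OF this assms[of z]]
    have s: "(\<lambda>i. (if i = m then u m * z ^ (q ^ m) else 0) - u i * z ^ (q ^ i))
        sums (u m * z ^ (q ^ m))" by simp
    have "absval (u m * z ^ (q ^ m)) \<le> B * \<epsilon> ^ (q ^ m + 1)"
    proof (rule sums_bound_field[OF s])
      fix i
      consider "i \<le> m" | "i > m" by linarith
      thus "absval ((if i = m then u m * z ^ (q ^ m) else 0) - u i * z ^ (q ^ i)) \<le> B * \<epsilon> ^ (q ^ m + 1)"
      proof cases
        case 1
        thus ?thesis using m(2)[of i] B(1) \<epsilon> by (cases "i = m") auto
      next
        case 2
        hence "q ^ m < q ^ i" using q_ge_2 by (intro power_strict_increasing) auto
        hence "\<epsilon> ^ (q ^ i) \<le> \<epsilon> ^ (q ^ m + 1)" using \<epsilon> by (intro power_decreasing) auto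
        hence "absval (u i) * \<epsilon> ^ (q ^ i) \<le> B * \<epsilon> ^ (q ^ m + 1)"
          using uB[of i] B(1) \<epsilon> by (intro mult_mono) auto
        thus ?thesis using 2 by (simp add: absval_mult absval_power z)
      qed
    qed
    hence "absval (u m) * \<epsilon> ^ (q ^ m) \<le> (B * \<epsilon>) * \<epsilon> ^ (q ^ m)"
      by (simp add: absval_mult absval_power z mult_ac)
    thus ?thesis using \<epsilon> unfolding \<epsilon>_def[symmetric] by (subst (asm) mult_le_cancel_right) auto
  qed
  have "(\<lambda>n. B * (1 / real q) ^ n) \<longlonglongrightarrow> B * 0"
    using q_ge_2 by (intro tendsto_mult tendsto_const LIMSEQ_power_zero) auto
  hence "absval (u m) \<le> B * 0"
    using small by (intro LIMSEQ_le_const) auto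
  thus False using m(1) by (simp add: absval_def)
qed

text \<open>The effect of \<tau>^k on a series: coefficients are raised to the q^k-th power and
  moved up by k places. It converts functional equations into recursions for coefficients.\<close>

lemma qseries_shift_power:
  assumes "(\<lambda>i. u i * z ^ (q ^ i)) sums (F :: 'c)"
  shows "(\<lambda>i. (if i < k then 0 else u (i - k) ^ (q ^ k)) * z ^ (q ^ i)) sums (F ^ (q ^ k))"
proof -
  have "(\<lambda>i. if i < k then 0 else (u (i - k) * z ^ (q ^ (i - k))) ^ (q ^ k)) sums (F ^ (q ^ k))"
    by (rule sums_shift_field[OF sums_power_q_power[OF assms]])
  also have "(\<lambda>i. if i < k then 0 else (u (i - k) * z ^ (q ^ (i - k))) ^ (q ^ k)) =
      (\<lambda>i. (if i < k then 0 else u (i - k) ^ (q ^ k)) * z ^ (q ^ i))"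
    by (auto simp: power_mult_distrib fun_eq_iff simp flip: power_mult power_add)
  finally show ?thesis .
qed

lemma qsum_add:
  assumes "qbound K u"
  shows "qsum u (x + y) = qsum u x + qsum u y"
  by (rule sums_unique2[OF qsum_sums[OF assms]])
    (use sums_add_field[OF qsum_sums[OF assms] qsum_sums[OF assms], of x y] in
      \<open>simp add: add_power_q_power distrib_left\<close>)

lemma qsum_diff:
  assumes "qbound K u"
  shows "qsum u (x - y) = qsum u x - qsum u y"
  using qsum_add[OF assms, of "x - y" y] by simp

lemma qsum_0 [simp]: "qsum u 0 = 0"
  by (simp add: qsum_def zero_power)

subsection \<open>The exponentials of the Carlitz modules\<close>

text \<open>
  The coefficients of the exponential of \<open>T \<mapsto> \<theta> + \<tau>\<^sup>k\<close>, indexed by powers of \<open>q\<close> for every \<open>k\<close>: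
  \<open>k = 1\<close> is the Carlitz module, \<open>k = 2\<close> the Carlitz module of the quadratic constant field
  extension.
\<close>

function exp_coeff :: "nat \<Rightarrow> nat \<Rightarrow> 'c" where
  "exp_coeff k i = (if i = 0 then 1 else if k = 0 \<or> i < k then 0
     else exp_coeff k (i - k) ^ (q ^ k) / (\<theta> ^ (q ^ i) - \<theta>))"
  by auto
termination by (relation "Wellfounded.measure snd") auto

declare exp_coeff.simps [simp del]

lemma exp_coeff_0 [simp]: "exp_coeff k 0 = 1"
  by (simp add: exp_coeff.simps)

lemma exp_coeff_rec:
  assumes "k > 0"
  shows "exp_coeff k i * (\<theta> ^ (q ^ i) - \<theta>) = (if i < k then 0 else exp_coeff k (i - k) ^ (q ^ k))"
  using assms theta_power_diff_nonzero[of i] by (subst exp_coeff.simps) auto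

text \<open>This sparsity makes the exponential linear over the field with q^k elements, not only
  over F_q.\<close>

lemma exp_coeff_eq_0:
  assumes "\<not> k dvd i"
  shows "exp_coeff k i = 0"
  using assms
proof (induction i rule: less_induct)
  case (less i)
  show ?case
  proof (cases "i < k \<or> k = 0")
    case True
    thus ?thesis using less.prems by (cases "i = 0") (auto simp: exp_coeff.simps[of k i])
  next
    case False
    hence "\<not> k dvd i - k" using less.prems by (simp add: dvd_minus_self)
    with less.IH[of "i - k"] False less.prems show ?thesis
      by (cases "i = 0") (auto simp: exp_coeff.simps[of k i] zero_power)
  qed
qed

lemma absval_exp_coeff_rec:
  assumes "k > 0" "i \<ge> k"
  shows "absval (exp_coeff k i) = absval (exp_coeff k (i - k)) ^ (q ^ k) / real q ^ (q ^ i)"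
  using assms absval_theta_power_diff[of i]
  by (subst exp_coeff.simps) (auto simp: absval_divide absval_power)

text \<open>The recursion replaces \<open>rate (i - k)\<close> by \<open>rate (i - k) / q\<close>,
  which is \<open>rate (i - k + 2)\<close> and hence at most \<open>rate i\<close> because k \<le>
  2.\<close>

lemma qbound_exp_coeff:
  assumes "k = 1 \<or> k = 2"
  shows "qbound 1 (exp_coeff k)"
proof -
  have "absval (exp_coeff k i) \<le> rate i ^ (q ^ i)" for i
  proof (induction i rule: less_induct)
    case (less i)
    consider "i = 0" | "0 < i" "i < k" | "i \<ge> k" "i > 0" using assms by linarith
    thus ?case
    proof cases
      case 3
      have "rate (i - k) / q = rate (Suc (Suc (i - k)))" by (simp add: rate_Suc_Suc)
      also have "\<dots> \<le> rate i" using assms by (intro rate_antimono) auto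
      finally have r: "rate (i - k) / q \<le> rate i" .
      have "absval (exp_coeff k i) = absval (exp_coeff k (i - k)) ^ (q ^ k) / real q ^ (q ^ i)"
        using 3 assms by (intro absval_exp_coeff_rec) auto
      also have "\<dots> \<le> (rate (i - k) ^ (q ^ (i - k))) ^ (q ^ k) / real q ^ (q ^ i)"
        using 3 assms by (intro divide_right_mono power_mono less.IH) auto
      also have "\<dots> = (rate (i - k) / q) ^ (q ^ i)"
        using 3 by (simp add: power_divide flip: power_mult power_add)
      also have "\<dots> \<le> rate i ^ (q ^ i)"
        using r by (intro power_mono) auto
      finally show ?thesis .
    qed (auto simp: exp_coeff.simps rate_def)
  qed
  thus ?thesis by (simp add: qbound_def)
qed

text \<open>Cruder in i than \<open>qbound\<close>, but for |z| \<le> q it bounds the i-th term by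
  (|z| / q)^(q^i), which compares directly with the linear term.\<close>

lemma absval_exp_coeff_le:
  assumes "k = 1 \<or> k = 2" "i > 0"
  shows "absval (exp_coeff k i) \<le> 1 / real q ^ (q ^ i)"
proof (cases "i < k")
  case True
  thus ?thesis using assms by (subst exp_coeff.simps) auto
next
  case False
  have "absval (exp_coeff k (i - k)) \<le> rate (i - k) ^ (q ^ (i - k))"
    using qbound_exp_coeff[OF assms(1)] by (simp add: qbound_def)
  also have "\<dots> \<le> 1" using rate_le_1 by (intro power_le_one) auto
  finally have "absval (exp_coeff k (i - k)) ^ (q ^ k) \<le> 1" by (intro power_le_one) auto
  thus ?thesis using False assms by (subst absval_exp_coeff_rec) (auto intro: divide_right_mono)
qed

definition carlitz_exp :: "nat \<Rightarrow> 'c \<Rightarrow> 'c" where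
  "carlitz_exp k = qsum (exp_coeff k)"

lemma carlitz_exp_sums:
  assumes "k = 1 \<or> k = 2"
  shows "(\<lambda>i. exp_coeff k i * z ^ (q ^ i)) sums carlitz_exp k z"
  unfolding carlitz_exp_def by (rule qsum_sums[OF qbound_exp_coeff[OF assms]])

lemma carlitz_exp_diff:
  assumes "k = 1 \<or> k = 2"
  shows "carlitz_exp k (x - y) = carlitz_exp k x - carlitz_exp k y"
  unfolding carlitz_exp_def by (rule qsum_diff[OF qbound_exp_coeff[OF assms]])

lemma carlitz_exp_add:
  assumes "k = 1 \<or> k = 2"
  shows "carlitz_exp k (x + y) = carlitz_exp k x + carlitz_exp k y"
  unfolding carlitz_exp_def by (rule qsum_add[OF qbound_exp_coeff[OF assms]])

lemma carlitz_exp_0 [simp]: "carlitz_exp k 0 = 0"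
  by (simp add: carlitz_exp_def)

lemma carlitz_exp_theta:
  assumes "k = 1 \<or> k = 2"
  shows "carlitz_exp k (\<theta> * z) = \<theta> * carlitz_exp k z + carlitz_exp k z ^ (q ^ k)"
proof (rule sums_unique2[OF carlitz_exp_sums[OF assms]])
  have k: "k > 0" using assms by auto
  show "(\<lambda>i. exp_coeff k i * (\<theta> * z) ^ (q ^ i)) sums (\<theta> * carlitz_exp k z + carlitz_exp k z ^ (q ^ k))"
    using sums_add_field[OF sums_mult_field[OF carlitz_exp_sums[OF assms], of \<theta> z]
        qseries_shift_power[OF carlitz_exp_sums[OF assms], of k z]]
    by (simp add: exp_coeff_rec[OF k, symmetric] algebra_simps power_mult_distrib)
qed

lemma absval_fixed_le_1:
  assumes "(c :: 'c) ^ n = c" "n \<ge> 2"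
  shows "absval c \<le> 1"
proof (rule ccontr)
  assume "\<not> absval c \<le> 1"
  hence "absval c ^ 1 < absval c ^ n" using assms by (intro power_strict_increasing) auto
  thus False using absval_power[of c n] assms(1) by simp
qed

lemma power_q_power_fixed:
  assumes "(c :: 'c) ^ (q ^ k) = c"
  shows "c ^ (q ^ (k * m)) = c"
  by (induction m) (simp_all add: power_add power_mult assms)

lemma carlitz_exp_scale:
  assumes "k = 1 \<or> k = 2" and c: "c ^ (q ^ k) = c"
  shows "carlitz_exp k (c * z) = c * carlitz_exp k z"
proof (rule sums_unique2[OF carlitz_exp_sums[OF assms(1)]])
  have "exp_coeff k i * (c * z) ^ (q ^ i) = c * (exp_coeff k i * z ^ (q ^ i))" for i
    using power_q_power_fixed[OF c] exp_coeff_eq_0[of k i]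
    by (cases "k dvd i") (auto simp: power_mult_distrib elim!: dvdE)
  thus "(\<lambda>i. exp_coeff k i * (c * z) ^ (q ^ i)) sums (c * carlitz_exp k z)"
    using sums_mult_field[OF carlitz_exp_sums[OF assms(1)], of c z] by (simp only:)
qed

text \<open>The bound \<open>B\<close> is left open since two are needed: |z| / q for the
  contraction and |z|^2 for the approximation of the logarithm.\<close>

lemma carlitz_exp_minus_id:
  assumes k: "k = 1 \<or> k = 2" and B: "\<And>i. i > 0 \<Longrightarrow> (absval z / q) ^ (q ^ i) \<le> B" "B \<ge> 0"
  shows "absval (carlitz_exp k z - z) \<le> B"
proof -
  have "(\<lambda>i. if i = 0 then z else 0) sums z" by (rule sums_single)
  from sums_diff_field[OF carlitz_exp_sums[OF k] this]
  show ?thesis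
  proof (rule sums_bound_field)
    fix i
    show "absval (exp_coeff k i * z ^ (q ^ i) - (if i = 0 then z else 0)) \<le> B"
    proof (cases "i = 0")
      case False
      have "absval (exp_coeff k i) * absval z ^ (q ^ i) \<le> 1 / real q ^ (q ^ i) * absval z ^ (q ^ i)"
        using absval_exp_coeff_le[OF k] False by (intro mult_right_mono) auto
      also have "\<dots> \<le> B" using B(1)[of i] False by (simp add: power_divide)
      finally show ?thesis using False by (simp add: absval_mult absval_power)
    qed (use B in auto)
  qed
qed

text \<open>For |z| \<le> q the base |z| / q is at most 1, so all its powers are at most itself. The
  ball of radius q is large enough to contain the \<theta>-torsion point from which the period is
  built.\<close>

lemma carlitz_exp_contraction:
  assumes k: "k = 1 \<or> k = 2" and z: "absval z \<le> q"
  shows "absval (carlitz_exp k z - z) \<le> 1 / q * absval z"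
proof (rule carlitz_exp_minus_id[OF k])
  fix i :: nat assume "i > 0"
  have "(absval z / q) ^ (q ^ i) \<le> (absval z / q) ^ 1"
    using z q_ge_2 by (intro power_decreasing) auto
  thus "(absval z / q) ^ (q ^ i) \<le> 1 / q * absval z" by simp
qed auto

text \<open>The linear term strictly dominates the rest. In particular 0 is the only zero in this
  ball, which gives unique logarithms and the base case for the description of the periods.\<close>

lemma carlitz_exp_isometry:
  assumes k: "k = 1 \<or> k = 2" and z: "absval z \<le> q"
  shows "absval (carlitz_exp k z) = absval z"
proof (cases "z = 0")
  case False
  have "1 / q * absval z < 1 * absval z"
    using False q_ge_2 by (intro mult_strict_right_mono) auto
  with carlitz_exp_contraction[OF assms] have "absval (carlitz_exp k z - z) < absval z" by simp
  from absval_add_eq[OF this] show ?thesis by simp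
qed auto

lemma carlitz_exp_onto:
  assumes k: "k = 1 \<or> k = 2" and w: "absval w \<le> q"
  shows "\<exists>z. absval z \<le> q \<and> carlitz_exp k z = w"
proof -
  have "\<exists>z. absval z \<le> q \<and> z + (carlitz_exp k z - z) = w"
    by (rule additive_contraction_solvable[of "1 / q"])
      (use q_ge_2 w carlitz_exp_contraction[OF k] in \<open>auto simp: carlitz_exp_diff[OF k]\<close>)
  thus ?thesis by simp
qed

text \<open>Horner form of the multiples of \<pi> by polynomials in \<theta> with digits in the
  field of q^k elements. It treats k = 1 and k = 2 alike, although the quadratic field occurs only
  as a set of fixed points.\<close>

inductive period_span :: "nat \<Rightarrow> 'c \<Rightarrow> 'c \<Rightarrow> bool" for k \<pi> where
  zero: "period_span k \<pi> 0"
| step: "c ^ (q ^ k) = c \<Longrightarrow> period_span k \<pi> x \<Longrightarrow> period_span k \<pi> (c * \<pi> + \<theta> * x)"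

text \<open>
  A period is \<open>\<theta>\<close> times the logarithm of a generator \<open>\<mu>\<close> of the \<open>\<theta>\<close>-torsion, which is the \<open>\<tau>\<^sup>k\<close>-fixed
  field times \<open>\<mu>\<close>; dividing a zero by \<open>\<theta>\<close> therefore reduces it to a smaller one.
\<close>

lemma carlitz_period:
  assumes k: "k = 1 \<or> k = 2"
  shows "\<exists>\<pi>. \<pi> \<noteq> 0 \<and> carlitz_exp k \<pi> = 0 \<and> 1 < absval (\<pi> / \<theta>) \<and> absval (\<pi> / \<theta>) \<le> q \<and>
    (\<forall>x. carlitz_exp k x = 0 \<longrightarrow> period_span k \<pi> x)"
proof -
  define Q where "Q = q ^ k"
  have "q ^ 1 \<le> q ^ k" using k q_ge_2 by (intro power_increasing) auto
  hence Q: "Q \<ge> 2" using q_ge_2 by (simp add: Q_def)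
  have Q_Suc: "Suc (Q - 1) = Q" using Q by simp
  \<comment> \<open>A nonzero solution of \<theta> \<mu> + \<mu>^Q = 0, that is, a \<theta>-torsion
    point. Its absolute value is the (Q - 1)-th root of q, so it lies in the range of the local
    logarithm.\<close>
  obtain \<mu> where \<mu>: "\<mu> ^ (Q - 1) = - \<theta>"
    using nth_root_exists[of "Q - 1" "- \<theta>"] Q by auto
  have \<mu>0: "\<mu> \<noteq> 0" using \<mu> Q by (auto simp: zero_power)
  have abs: "absval \<mu> ^ (Q - 1) = q"
    unfolding absval_power[symmetric] \<mu> by (simp add: absval_theta)
  have gt: "absval \<mu> > 1"
  proof (rule ccontr)
    assume "\<not> absval \<mu> > 1"
    hence "absval \<mu> ^ (Q - 1) \<le> 1" by (intro power_le_one) auto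
    thus False using abs q_ge_2 by simp
  qed
  have le: "absval \<mu> \<le> q"
  proof -
    have "absval \<mu> ^ 1 \<le> absval \<mu> ^ (Q - 1)" using gt Q by (intro power_increasing) auto
    thus ?thesis by (simp only: abs power_one_right)
  qed
  obtain z where z: "absval z \<le> q" "carlitz_exp k z = \<mu>"
    using carlitz_exp_onto[OF k le] by blast
  have z_abs: "absval z = absval \<mu>" using carlitz_exp_isometry[OF k z(1)] z(2) by simp
  have \<mu>Q: "\<mu> ^ Q = - \<theta> * \<mu>" using \<mu> power_Suc2[of \<mu> "Q - 1"] unfolding Q_Suc by simp
  define \<pi> where "\<pi> = \<theta> * z"
  have z_eq: "\<pi> / \<theta> = z" by (simp add: \<pi>_def)
  have \<pi>: "carlitz_exp k \<pi> = 0"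
    using carlitz_exp_theta[OF k, of z] \<mu>Q by (simp add: \<pi>_def z Q_def)
  \<comment> \<open>Extraction of one digit: the exponential maps x / \<theta> to a torsion point,
    which is c times \<mu>; subtracting c z from x / \<theta> leaves a zero again.\<close>
  have step: "\<exists>c x'. c ^ (q ^ k) = c \<and> carlitz_exp k x' = 0 \<and> x = c * \<pi> + \<theta> * x' \<and>
      absval x' \<le> max (absval x / q) q" if x: "carlitz_exp k x = 0" for x
  proof -
    define \<nu> where "\<nu> = carlitz_exp k (x / \<theta>)"
    have \<nu>: "\<theta> * \<nu> + \<nu> ^ Q = 0"
      using carlitz_exp_theta[OF k, of "x / \<theta>"] x by (simp add: \<nu>_def Q_def)
    define c where "c = \<nu> / \<mu>"
    have "c ^ Q * \<mu> ^ Q = \<nu> ^ Q" using \<mu>0 by (simp add: c_def power_divide)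
    also have "\<dots> = - \<theta> * \<nu>" using \<nu> by (simp add: eq_neg_iff_add_eq_0 add.commute)
    also have "\<dots> = c * \<mu> ^ Q" using \<mu>0 by (simp add: c_def \<mu>Q)
    finally have c: "c ^ Q = c" using \<mu>0 by simp
    define x' where "x' = x / \<theta> - c * z"
    have "carlitz_exp k x' = 0"
      using c \<mu>0 by (simp add: x'_def carlitz_exp_diff[OF k] carlitz_exp_scale[OF k] Q_def z
          \<nu>_def[symmetric], simp add: c_def)
    moreover have "x = c * \<pi> + \<theta> * x'" by (simp add: x'_def \<pi>_def algebra_simps)
    moreover have "absval c \<le> 1" using c Q by (rule absval_fixed_le_1)
    hence "absval (c * z) \<le> q"
      using mult_mono[of "absval c" 1 "absval z" "real q"] z(1) by (simp add: absval_mult)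
    hence "absval x' \<le> max (absval x / q) q"
      using absval_diff[of "x / \<theta>" "c * z"] unfolding x'_def
      by (simp add: absval_divide absval_theta)
    ultimately show ?thesis using c unfolding Q_def by blast
  qed
  have "period_span k \<pi> x" if "carlitz_exp k x = 0" for x
  proof -
    \<comment> \<open>Each digit divides the bound by q until the zero lies in the ball of radius q,
      where the isometry forces it to be 0.\<close>
    have bounded: "period_span k \<pi> x" if "carlitz_exp k x = 0" "absval x \<le> real q ^ Suc n" for n x
      using that
    proof (induction n arbitrary: x)
      case 0
      hence "x = 0" using carlitz_exp_isometry[OF k, of x] by simp
      thus ?case by (simp add: period_span.zero)
    next
      case (Suc n)
      obtain c x' where *: "c ^ (q ^ k) = c" "carlitz_exp k x' = 0" "x = c * \<pi> + \<theta> * x'"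
          "absval x' \<le> max (absval x / q) q"
        using step[OF Suc.prems(1)] by blast
      have "absval x / q \<le> real q ^ Suc n"
        using Suc.prems(2) by (simp add: field_simps)
      moreover have "real q \<le> real q ^ Suc n"
        using q_ge_2 by (intro self_le_power) auto
      ultimately have "absval x' \<le> real q ^ Suc n" using *(4) by linarith
      thus ?case using period_span.step[OF *(1) Suc.IH[OF *(2)]] *(3) by simp
    qed
    obtain n where "absval x < real q ^ n"
      using real_arch_pow[of "real q"] q_ge_2 by auto
    moreover have "real q ^ n \<le> real q ^ Suc n"
      using q_ge_2 by (intro power_increasing) auto
    ultimately have "absval x \<le> real q ^ Suc n" by linarith
    thus ?thesis using \<open>carlitz_exp k x = 0\<close> bounded by blast
  qed
  moreover have "\<pi> \<noteq> 0" using z_abs gt by (auto simp: \<pi>_def)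
  ultimately show ?thesis
    using \<pi> gt le z_eq z_abs by (intro exI[of _ \<pi>]) simp
qed

subsection \<open>Finite subfields\<close>

text \<open>X^n - X has at most n roots, so n known ones exhaust them.\<close>

lemma power_fixed_points_eq:
  assumes "card S = n" "n \<ge> 2" "\<And>c. c \<in> S \<Longrightarrow> (c :: 'c) ^ n = c"
  shows "{c. c ^ n = c} = S"
proof -
  define p :: "'c poly" where "p = monom 1 n - monom 1 1"
  have "coeff p n = 1" using assms(2) by (simp add: p_def)
  hence p: "p \<noteq> 0" by auto
  have deg: "degree p \<le> n"
    unfolding p_def using assms(2) by (intro degree_diff_le) (auto simp: degree_monom_eq)
  have roots: "{c. poly p c = 0} = {c. c ^ n = c}"
    by (simp add: p_def poly_monom)
  have fin: "finite {c :: 'c. c ^ n = c}"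
    using poly_roots_finite[OF p] by (simp add: roots)
  have "card {c :: 'c. c ^ n = c} \<le> card S"
    using card_poly_roots_bound[OF p] deg assms(1) by (simp add: roots)
  thus ?thesis using card_seteq[OF fin, of S] assms(3) by auto
qed

lemma fls_const_eq_iff: "fls_const c = fls_const d \<longleftrightarrow> c = (d :: 'k)"
  by (metis fls_const_nth)

lemma embed_const_power_q: "\<iota> (fls_const c) ^ q = \<iota> (fls_const c)"
proof -
  have "fls_const c ^ q = fls_const (c ^ q)"
    by (induction q) (auto simp: fls_const_mult_const)
  thus ?thesis by (simp add: card_k finite_field_power_card_eq_same flip: embed_power)
qed

lemma power_q_fixed_imp_F_q:
  assumes "c ^ q = c"
  shows "\<exists>d. c = \<iota> (fls_const d)"
proof -
  have "{c. c ^ q = c} = range (\<lambda>d. \<iota> (fls_const d))"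
    by (rule power_fixed_points_eq)
      (use q_ge_2 embed_const_power_q in \<open>auto simp: card_image inj_on_def embed_inj fls_const_eq_iff card_k\<close>)
  thus ?thesis using assms by auto
qed

text \<open>The q^2 elements d + \<omega> e are fixed by the q^2-power map, and they are distinct
  because \<omega> is not in the image of \<iota>.\<close>

lemma power_q2_fixed_imp_F_q2:
  assumes \<omega>: "\<omega> \<in> F_q2 \<iota> - F_q \<iota>" and c: "c ^ (q ^ 2) = c"
  shows "\<exists>d e. c = \<iota> (fls_const d) + \<omega> * \<iota> (fls_const e)"
proof -
  define f where "f = (\<lambda>(d, e). \<iota> (fls_const d) + \<omega> * \<iota> (fls_const e))"
  have \<omega>Q: "\<omega> ^ (q ^ 2) = \<omega>" using \<omega> by (simp add: F_q2_def card_k)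
  have Q: "\<iota> (fls_const d) ^ (q ^ 2) = \<iota> (fls_const d)" for d
    by (simp add: power2_eq_square power_mult embed_const_power_q)
  have "inj f"
  proof (rule injI)
    fix x y assume "f x = f y"
    moreover obtain d e d' e' where xy: "x = (d, e)" "y = (d', e')" by fastforce
    ultimately have eq: "\<iota> (fls_const d - fls_const d') = \<omega> * \<iota> (fls_const e' - fls_const e)"
      by (simp add: f_def algebra_simps embed_add[of _ "- _", simplified] embed_minus)
    have "e = e'"
    proof (rule ccontr)
      assume "e \<noteq> e'"
      hence ne: "fls_const e' - fls_const e \<noteq> 0" by (simp add: fls_const_eq_iff)
      have "\<iota> (fls_const d - fls_const d') =
          \<iota> ((fls_const d - fls_const d') / (fls_const e' - fls_const e)) * \<iota> (fls_const e' - fls_const e)"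
        using ne by (simp flip: embed_mult)
      hence "\<omega> = \<iota> ((fls_const d - fls_const d') / (fls_const e' - fls_const e))"
        using eq ne by (simp add: embed_eq_0_iff)
      thus False using F_q2_not_embed[OF \<omega>] by blast
    qed
    with eq have "d = d'" by (simp add: embed_eq_0_iff embed_zero fls_const_eq_iff)
    thus "x = y" using xy \<open>e = e'\<close> by simp
  qed
  hence card: "card (range f) = q ^ 2"
    by (simp add: card_image card_k power2_eq_square)
  have "{c. c ^ (q ^ 2) = c} = range f"
  proof (rule power_fixed_points_eq[OF card])
    show "q ^ 2 \<ge> 2" using q_ge_2 self_le_power[of q 2] by simp
    fix c assume "c \<in> range f"
    thus "c ^ (q ^ 2) = c"
      by (auto simp: f_def add_power_q_power power_mult_distrib \<omega>Q Q)
  qed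
  hence "c \<in> range f" using c by blast
  thus ?thesis by (auto simp: f_def)
qed

subsection \<open>Extensions of the quadratic Carlitz module by the Carlitz module\<close>

text \<open>
  The second component of the exponential is \<open>carlitz_exp 1 z\<^sub>2 + ext_exp a z\<^sub>1\<close>, where \<open>ext_exp a\<close>
  satisfies \<open>ext_exp_theta\<close> below; \<open>quasi\<close> is its derivative with respect to \<open>a\<close> at \<open>a = 0\<close>.
\<close>

primrec ext_coeff :: "'c \<Rightarrow> nat \<Rightarrow> 'c" where
  "ext_coeff a 0 = 0"
| "ext_coeff a (Suc i) = (ext_coeff a i ^ q + a * exp_coeff 2 i ^ q) / (\<theta> ^ (q ^ Suc i) - \<theta>)"

primrec quasi_coeff :: "nat \<Rightarrow> 'c" where
  "quasi_coeff 0 = 0"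
| "quasi_coeff (Suc i) = exp_coeff 2 i ^ q / (\<theta> ^ (q ^ Suc i) - \<theta>)"

definition ext_exp :: "'c \<Rightarrow> 'c \<Rightarrow> 'c" where
  "ext_exp a = qsum (ext_coeff a)"

definition quasi :: "'c \<Rightarrow> 'c" where
  "quasi = qsum quasi_coeff"

text \<open>The common induction step for \<open>quasi_coeff\<close> and \<open>ext_coeff\<close>:
  the denominator contributes 1/q to the base, and \<open>rate i / q\<close> is
  \<open>rate (i + 2)\<close>, so the step to \<open>rate (i + 1)\<close> even leaves some
  room.\<close>

lemma rate_step:
  assumes "absval x \<le> K * rate i ^ (q ^ Suc i)" "K \<ge> 0"
  shows "absval (x / (\<theta> ^ (q ^ Suc i) - \<theta>)) \<le> K * rate (Suc i) ^ (q ^ Suc i)"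
proof -
  have "absval (x / (\<theta> ^ (q ^ Suc i) - \<theta>)) = absval x / real q ^ (q ^ Suc i)"
    by (simp only: absval_divide absval_theta_power_diff[OF zero_less_Suc])
  also have "\<dots> \<le> K * rate i ^ (q ^ Suc i) / real q ^ (q ^ Suc i)"
    using assms(1) by (rule divide_right_mono) simp
  also have "\<dots> = K * (rate i / q) ^ (q ^ Suc i)" by (simp add: power_divide)
  also have "\<dots> \<le> K * rate (Suc i) ^ (q ^ Suc i)"
    using assms(2) rate_antimono[of "Suc i" "Suc (Suc i)"]
    by (intro mult_left_mono power_mono) (auto simp: rate_Suc_Suc)
  finally show ?thesis .
qed

lemma absval_exp_coeff_power_q_le: "absval (exp_coeff 2 i) ^ q \<le> rate i ^ (q ^ Suc i)"
proof -
  have "absval (exp_coeff 2 i) ^ q \<le> (rate i ^ (q ^ i)) ^ q"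
    using qbound_exp_coeff[of 2] by (intro power_mono) (auto simp: qbound_def)
  also have "\<dots> = rate i ^ (q ^ Suc i)" by (simp add: mult.commute flip: power_mult)
  finally show ?thesis .
qed

lemma qbound_quasi_coeff: "qbound 1 quasi_coeff"
  unfolding qbound_def
proof
  fix i show "absval (quasi_coeff i) \<le> 1 * rate i ^ (q ^ i)"
  proof (cases i)
    case (Suc j)
    have "absval (exp_coeff 2 j ^ q) \<le> 1 * rate j ^ (q ^ Suc j)"
      using absval_exp_coeff_power_q_le[of j] by (simp add: absval_power)
    from rate_step[OF this] show ?thesis unfolding Suc quasi_coeff.simps by simp
  qed simp
qed

text \<open>Since |a| \<le> 1, taking q-th powers does not increase |a|, so a single factor |a|
  survives the recursion.\<close>

lemma qbound_ext_coeff: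
  assumes "absval a \<le> 1"
  shows "qbound (absval a) (ext_coeff a)"
proof -
  have "absval (ext_coeff a i) \<le> absval a * rate i ^ (q ^ i)" for i
  proof (induction i)
    case (Suc i)
    have "absval a ^ q \<le> absval a ^ 1"
      using assms q_ge_2 by (intro power_decreasing) auto
    hence aq: "absval a ^ q \<le> absval a" by simp
    have "absval (ext_coeff a i ^ q) \<le> (absval a * rate i ^ (q ^ i)) ^ q"
      unfolding absval_power by (intro power_mono Suc.IH) auto
    also have "\<dots> = absval a ^ q * rate i ^ (q ^ Suc i)"
      by (simp add: power_mult_distrib mult.commute flip: power_mult)
    also have "\<dots> \<le> absval a * rate i ^ (q ^ Suc i)"
      using aq by (rule mult_right_mono) simp
    finally have 1: "absval (ext_coeff a i ^ q) \<le> absval a * rate i ^ (q ^ Suc i)" .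
    have 2: "absval (a * exp_coeff 2 i ^ q) \<le> absval a * rate i ^ (q ^ Suc i)"
      unfolding absval_mult absval_power by (intro mult_left_mono absval_exp_coeff_power_q_le) simp
    have "absval (ext_coeff a i ^ q + a * exp_coeff 2 i ^ q) \<le> absval a * rate i ^ (q ^ Suc i)"
      using absval_add[of "ext_coeff a i ^ q" "a * exp_coeff 2 i ^ q"] 1 2 by linarith
    from rate_step[OF this] show ?case unfolding ext_coeff.simps by simp
  qed simp
  thus ?thesis by (simp add: qbound_def)
qed

text \<open>Written with \<open>i < 1\<close> and \<open>q ^ 1\<close> so that it fits
  \<open>qseries_shift_power\<close> at k = 1.\<close>

lemma ext_coeff_rec:
  "ext_coeff a i * (\<theta> ^ (q ^ i) - \<theta>) =
     (if i < 1 then 0 else ext_coeff a (i - 1) ^ (q ^ 1)) + a * (if i < 1 then 0 else exp_coeff 2 (i - 1) ^ (q ^ 1))"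
  using theta_power_diff_nonzero[of i] by (cases i) simp_all

text \<open>The recursion uses \<open>a\<close> linearly and earlier coefficients through q-th
  powers, so the coefficients are additive, though not linear, in \<open>a\<close>.\<close>

lemma ext_coeff_diff: "ext_coeff (a - b) i = ext_coeff a i - ext_coeff b i"
proof (induction i)
  case (Suc i)
  thus ?case
    using diff_power_q_power[of "ext_coeff a i" "ext_coeff b i" 1]
    by (simp add: left_diff_distrib add_diff_add flip: diff_divide_distrib)
qed simp

lemma ext_exp_sums:
  assumes "absval a \<le> 1"
  shows "(\<lambda>i. ext_coeff a i * z ^ (q ^ i)) sums ext_exp a z"
  unfolding ext_exp_def by (rule qsum_sums[OF qbound_ext_coeff[OF assms]])

lemma ext_exp_add:
  assumes "absval a \<le> 1"
  shows "ext_exp a (x + y) = ext_exp a x + ext_exp a y"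
  unfolding ext_exp_def by (rule qsum_add[OF qbound_ext_coeff[OF assms]])

lemma ext_exp_0 [simp]: "ext_exp a 0 = 0"
  by (simp add: ext_exp_def)

lemma ext_exp_param_diff:
  assumes "absval a \<le> 1" "absval b \<le> 1"
  shows "ext_exp (a - b) z = ext_exp a z - ext_exp b z"
proof -
  have "absval (a - b) \<le> 1" using absval_diff[of a b] assms by simp
  from sums_unique2[OF ext_exp_sums[OF this, of z]]
  show ?thesis
    using sums_diff_field[OF ext_exp_sums[OF assms(1), of z] ext_exp_sums[OF assms(2), of z]]
    by (simp add: ext_coeff_diff left_diff_distrib)
qed

lemma ext_exp_scale:
  assumes "absval a \<le> 1" and c: "c ^ q = c"
  shows "ext_exp a (c * z) = c * ext_exp a z"
proof (rule sums_unique2[OF ext_exp_sums[OF assms(1)]])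
  have "ext_coeff a i * (c * z) ^ (q ^ i) = c * (ext_coeff a i * z ^ (q ^ i))" for i
    using power_q_power_fixed[of c 1 i] c by (simp add: power_mult_distrib)
  thus "(\<lambda>i. ext_coeff a i * (c * z) ^ (q ^ i)) sums (c * ext_exp a z)"
    using sums_mult_field[OF ext_exp_sums[OF assms(1)], of c z] by (simp only:)
qed

lemma ext_exp_theta:
  assumes "absval a \<le> 1"
  shows "ext_exp a (\<theta> * z) = \<theta> * ext_exp a z + a * carlitz_exp 2 z ^ q + ext_exp a z ^ q"
proof (rule sums_unique2[OF ext_exp_sums[OF assms]])
  let ?s = "\<lambda>u i. if i < 1 then 0 else u (i - 1) ^ (q ^ 1) :: 'c"
  have "(\<lambda>i. \<theta> * (ext_coeff a i * z ^ (q ^ i)) + (a * (?s (exp_coeff 2) i * z ^ (q ^ i)) +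
      ?s (ext_coeff a) i * z ^ (q ^ i)))
      sums (\<theta> * ext_exp a z + (a * carlitz_exp 2 z ^ (q ^ 1) + ext_exp a z ^ (q ^ 1)))"
    by (intro sums_add_field sums_mult_field qseries_shift_power ext_exp_sums assms carlitz_exp_sums) simp
  also have "(\<lambda>i. \<theta> * (ext_coeff a i * z ^ (q ^ i)) + (a * (?s (exp_coeff 2) i * z ^ (q ^ i)) +
      ?s (ext_coeff a) i * z ^ (q ^ i))) = (\<lambda>i. ext_coeff a i * (\<theta> * z) ^ (q ^ i))"
  proof
    fix i
    have "\<theta> * (ext_coeff a i * z ^ (q ^ i)) + (a * (?s (exp_coeff 2) i * z ^ (q ^ i)) +
      ?s (ext_coeff a) i * z ^ (q ^ i)) =
      (\<theta> * ext_coeff a i + (?s (ext_coeff a) i + a * ?s (exp_coeff 2) i)) * z ^ (q ^ i)"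
      by (simp only: algebra_simps)
    also have "\<dots> = ext_coeff a i * (\<theta> * z) ^ (q ^ i)"
      by (simp only: ext_coeff_rec[symmetric]) (simp add: power_mult_distrib algebra_simps)
    finally show "\<theta> * (ext_coeff a i * z ^ (q ^ i)) + (a * (?s (exp_coeff 2) i * z ^ (q ^ i)) +
      ?s (ext_coeff a) i * z ^ (q ^ i)) = ext_coeff a i * (\<theta> * z) ^ (q ^ i)" .
  qed
  finally show "(\<lambda>i. ext_coeff a i * (\<theta> * z) ^ (q ^ i))
      sums (\<theta> * ext_exp a z + a * carlitz_exp 2 z ^ q + ext_exp a z ^ q)"
    by (simp add: add.assoc)
qed

lemma quasi_sums: "(\<lambda>i. quasi_coeff i * z ^ (q ^ i)) sums quasi z"
  unfolding quasi_def by (rule qsum_sums[OF qbound_quasi_coeff])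

text \<open>Only odd indices i carry nonzero coefficients, and for those c^(q^i) = c^q. The mismatch
  between this c^q and the factor c of a linear map produces \<omega> - \<omega>^q.\<close>

lemma quasi_scale:
  assumes c: "c ^ (q ^ 2) = c"
  shows "quasi (c * z) = c ^ q * quasi z"
proof (rule sums_unique2[OF quasi_sums])
  have "quasi_coeff i * (c * z) ^ (q ^ i) = c ^ q * (quasi_coeff i * z ^ (q ^ i))" for i
  proof (cases i)
    case (Suc j)
    show ?thesis
    proof (cases "2 dvd j")
      case True
      then obtain m where m: "j = 2 * m" by blast
      have "c ^ (q ^ i) = (c ^ (q ^ (2 * m))) ^ q"
        by (simp add: Suc m mult.commute flip: power_mult)
      also have "\<dots> = c ^ q" by (simp only: power_q_power_fixed[OF c])
      finally show ?thesis by (simp add: power_mult_distrib)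
    next
      case False
      hence "quasi_coeff i = 0" by (simp add: Suc exp_coeff_eq_0 zero_power)
      thus ?thesis by simp
    qed
  qed simp
  thus "(\<lambda>i. quasi_coeff i * (c * z) ^ (q ^ i)) sums (c ^ q * quasi z)"
    using sums_mult_field[OF quasi_sums, of "c ^ q" z] by (simp only:)
qed

text \<open>With y = |z / \<theta>| the first term has absolute value y^q > 1. The term at 2
  vanishes and the later ones are at most 1, since \<open>rate j\<close> \<le> 1/q compensates y
  \<le> q.\<close>

lemma quasi_nonzero:
  assumes "absval (z / \<theta>) > 1" "absval (z / \<theta>) \<le> q"
  shows "quasi z \<noteq> 0"
proof
  define y where "y = absval (z / \<theta>)"
  have z: "absval z = q * y" by (simp add: y_def absval_divide absval_theta)
  have y: "1 < y" "y \<le> q" using assms by (auto simp: y_def)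
  assume 0: "quasi z = 0"
  \<comment> \<open>If the sum is 0, the first term equals the sum of a series whose entry at index
    1 is 0.\<close>
  have "(\<lambda>i. if i = 1 then quasi_coeff 1 * z ^ (q ^ 1) else 0) sums (quasi_coeff 1 * z ^ (q ^ 1))"
    by (rule sums_single)
  from sums_diff_field[OF this quasi_sums[of z]]
  have s: "(\<lambda>i. (if i = 1 then quasi_coeff 1 * z ^ (q ^ 1) else 0) - quasi_coeff i * z ^ (q ^ i))
      sums (quasi_coeff 1 * z ^ (q ^ 1))" by (simp add: 0)
  have "absval (quasi_coeff 1 * z ^ (q ^ 1)) \<le> 1"
  proof (rule sums_bound_field[OF s])
    fix i
    consider "i = 0" | "i = 1" | "i = 2" | j where "i = Suc j" "j \<ge> 2"
      by (metis One_nat_def Suc_1 less_2_cases not_less_eq_eq not0_implies_Suc linorder_not_less)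
    thus "absval ((if i = 1 then quasi_coeff 1 * z ^ (q ^ 1) else 0) - quasi_coeff i * z ^ (q ^ i)) \<le> 1"
    proof cases
      case 3
      have "exp_coeff 2 1 = 0" by (rule exp_coeff_eq_0) simp
      thus ?thesis using 3 by (simp add: numeral_2_eq_2 zero_power)
    next
      case (4 j)
      have r: "rate j \<le> 1 / q"
        using rate_antimono[OF 4(2)] rate_Suc_Suc[of 0] by (simp add: numeral_2_eq_2 rate_def)
      have "absval (quasi_coeff i) = absval (exp_coeff 2 j) ^ q / real q ^ (q ^ i)"
        unfolding 4(1) quasi_coeff.simps
        by (simp only: absval_divide absval_theta_power_diff[OF zero_less_Suc] absval_power)
      also have "\<dots> \<le> rate j ^ (q ^ i) / real q ^ (q ^ i)"
        unfolding 4(1) by (intro divide_right_mono absval_exp_coeff_power_q_le) simp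
      finally have "absval (quasi_coeff i) * absval z ^ (q ^ i) \<le>
          rate j ^ (q ^ i) / real q ^ (q ^ i) * absval z ^ (q ^ i)"
        by (intro mult_right_mono) auto
      also have "\<dots> = (rate j * y) ^ (q ^ i)"
        by (simp add: z power_mult_distrib)
      also have "\<dots> \<le> 1"
      proof (rule power_le_one)
        show "rate j * y \<ge> 0" using y by simp
        have "rate j * y \<le> 1 / q * q" using r y by (intro mult_mono) auto
        thus "rate j * y \<le> 1" by simp
      qed
      finally have "absval (quasi_coeff i * z ^ (q ^ i)) \<le> 1"
        by (simp only: absval_mult absval_power)
      thus ?thesis using 4 by (simp del: quasi_coeff.simps)
    qed simp_all
  qed
  moreover have "absval (quasi_coeff 1 * z ^ (q ^ 1)) = y ^ q"
    using absval_theta_power_diff[of 1]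
    by (simp add: absval_mult absval_divide absval_power z power_mult_distrib)
  moreover have "y ^ q > 1" using y q_ge_2 by (intro one_less_power) auto
  ultimately show False by simp
qed

text \<open>Subtracting \<open>a * quasi_coeff\<close> from \<open>ext_coeff a\<close> cancels the
  summand linear in \<open>a\<close> and leaves a q-th power of the preceding coefficient, of order
  |a|^q \<le> |a|^2.\<close>

lemma ext_exp_approx:
  "\<exists>B>0. \<forall>a. absval a \<le> 1 \<longrightarrow>
     absval (ext_exp a z) \<le> absval a * B \<and> absval (ext_exp a z - a * quasi z) \<le> (absval a)\<^sup>2 * B"
proof -
  obtain B where B: "B > 0" "\<And>K u. K \<ge> 0 \<Longrightarrow> qbound K u \<Longrightarrow> absval (qsum u z) \<le> K * B"
    using qsum_bound[of z] by blast
  have "absval (ext_exp a z - a * quasi z) \<le> (absval a)\<^sup>2 * B" if a: "absval a \<le> 1" for a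
  proof -
    define k where "k i = ext_coeff a i - a * quasi_coeff i" for i
    have a2: "absval a ^ q \<le> (absval a)\<^sup>2"
      using a q_ge_2 by (intro power_decreasing) auto
    have "qbound ((absval a)\<^sup>2) k"
      unfolding qbound_def
    proof
      fix i show "absval (k i) \<le> (absval a)\<^sup>2 * rate i ^ (q ^ i)"
      proof (cases i)
        case (Suc j)
        have "absval (ext_coeff a j ^ q) \<le> (absval a * rate j ^ (q ^ j)) ^ q"
          unfolding absval_power using qbound_ext_coeff[OF a]
          by (intro power_mono) (auto simp: qbound_def)
        also have "\<dots> = absval a ^ q * rate j ^ (q ^ Suc j)"
          by (simp add: power_mult_distrib mult.commute flip: power_mult)
        also have "\<dots> \<le> (absval a)\<^sup>2 * rate j ^ (q ^ Suc j)"
          using a2 by (rule mult_right_mono) simp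
        finally have "absval (ext_coeff a j ^ q) \<le> (absval a)\<^sup>2 * rate j ^ (q ^ Suc j)" .
        from rate_step[OF this]
        have "absval (ext_coeff a j ^ q / (\<theta> ^ (q ^ Suc j) - \<theta>)) \<le> (absval a)\<^sup>2 * rate (Suc j) ^ (q ^ Suc j)"
          by simp
        moreover have "k i = ext_coeff a j ^ q / (\<theta> ^ (q ^ Suc j) - \<theta>)"
          unfolding k_def Suc ext_coeff.simps quasi_coeff.simps
          by (simp add: add_divide_distrib)
        ultimately show ?thesis unfolding Suc by (simp only:)
      qed (simp add: k_def)
    qed
    hence "absval (qsum k z) \<le> (absval a)\<^sup>2 * B" by (intro B) auto
    moreover have "qsum k z = ext_exp a z - a * quasi z"
      using sums_unique2[OF qsum_sums[OF \<open>qbound _ k\<close>, of z]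
          sums_diff_field[OF ext_exp_sums[OF a, of z] sums_mult_field[OF quasi_sums, of a z],
            unfolded mult.assoc[symmetric] left_diff_distrib[symmetric], folded k_def]] .
    ultimately show ?thesis by simp
  qed
  moreover have "absval (ext_exp a z) \<le> absval a * B" if a: "absval a \<le> 1" for a
    unfolding ext_exp_def by (intro B qbound_ext_coeff[OF a]) simp
  ultimately show ?thesis using B(1) by blast
qed

section \<open>The local logarithm and the inversion of the Siegel entry\<close>

definition carlitz_log :: "'c \<Rightarrow> 'c" where
  "carlitz_log w = (SOME z. absval z \<le> q \<and> carlitz_exp 1 z = w)"

lemma carlitz_log:
  assumes "absval w \<le> q"
  shows "absval (carlitz_log w) \<le> q" "carlitz_exp 1 (carlitz_log w) = w"
    "absval (carlitz_log w) = absval w"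
proof -
  have "\<exists>z. absval z \<le> q \<and> carlitz_exp 1 z = w"
    using carlitz_exp_onto[OF _ assms, of 1] by simp
  from someI_ex[OF this]
  show *: "absval (carlitz_log w) \<le> q" "carlitz_exp 1 (carlitz_log w) = w"
    unfolding carlitz_log_def by auto
  show "absval (carlitz_log w) = absval w"
    using carlitz_exp_isometry[OF _ *(1), of 1] *(2) by simp
qed

text \<open>The defect of additivity lies in the ball of radius q and is a zero of the exponential,
  hence 0 by the isometry.\<close>

lemma carlitz_log_diff:
  assumes "absval v \<le> q" "absval w \<le> q"
  shows "carlitz_log (v - w) = carlitz_log v - carlitz_log w"
proof -
  have vw: "absval (v - w) \<le> q" using absval_diff[of v w] assms by linarith
  define d where "d = carlitz_log (v - w) - (carlitz_log v - carlitz_log w)"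
  have "absval d \<le> q"
    using absval_diff[of "carlitz_log (v - w)" "carlitz_log v - carlitz_log w"]
      absval_diff[of "carlitz_log v" "carlitz_log w"] carlitz_log(1)[OF vw]
      carlitz_log(1)[OF assms(1)] carlitz_log(1)[OF assms(2)]
    unfolding d_def by linarith
  moreover have "carlitz_exp 1 d = 0"
    using carlitz_log(2)[OF vw] carlitz_log(2)[OF assms(1)] carlitz_log(2)[OF assms(2)]
    by (simp add: d_def carlitz_exp_diff)
  ultimately have "d = 0" using carlitz_exp_isometry[of 1 d] by simp
  thus ?thesis by (simp add: d_def)
qed

text \<open>With z the logarithm of w, the error is that of the exponential at z, where |z| = |w|;
  its terms have exponents q^i \<ge> 2.\<close>

lemma carlitz_log_approx:
  assumes "absval w \<le> 1"
  shows "absval (carlitz_log w - w) \<le> (absval w)\<^sup>2"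
proof -
  define z where "z = carlitz_log w"
  have w: "absval w \<le> q" using assms q_ge_2 by linarith
  have z: "carlitz_exp 1 z = w" "absval z = absval w"
    using carlitz_log[OF w] by (simp_all add: z_def)
  have "absval (carlitz_exp 1 z - z) \<le> (absval z)\<^sup>2"
  proof (rule carlitz_exp_minus_id)
    fix i :: nat assume i: "i > 0"
    have "(absval z / q) ^ (q ^ i) \<le> absval z ^ (q ^ i)"
      using q_ge_2 mult_right_mono[of 1 "real q" "absval z"]
      by (intro power_mono) (auto simp: divide_le_eq mult.commute)
    also have "q \<le> q ^ i" using i q_ge_2 by (intro self_le_power) auto
    hence "absval z ^ (q ^ i) \<le> (absval z)\<^sup>2"
      using assms q_ge_2 z by (intro power_decreasing) auto
    finally show "(absval z / q) ^ (q ^ i) \<le> (absval z)\<^sup>2" .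
  qed auto
  thus ?thesis using absval_minus[of "w - z"] z by (simp add: z_def)
qed

text \<open>
  As a function of the extension parameter \<open>a\<close>, the entry \<open>s\<close> of the Siegel matrix is additive with
  derivative \<open>(\<omega> - \<omega>\<^sup>q) quasi \<pi>\<^sub>2 / \<pi>\<^sub>1\<close> at \<open>0\<close>.
\<close>

lemma ext_parameter_exists:
  assumes \<omega>: "\<omega> \<in> F_q2 \<iota> - F_q \<iota>" and \<pi>\<^sub>2: "quasi \<pi>\<^sub>2 \<noteq> 0" and \<pi>\<^sub>1: "\<pi>\<^sub>1 \<noteq> 0"
  shows "\<exists>\<delta>>0. \<forall>s. absval s < \<delta> \<longrightarrow> (\<exists>a x y. absval a \<le> 1 \<and>
    carlitz_exp 1 x = - ext_exp a \<pi>\<^sub>2 \<and> carlitz_exp 1 y = - ext_exp a (\<omega> * \<pi>\<^sub>2) \<and> y - \<omega> * x = s * \<pi>\<^sub>1)"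
proof -
  have \<omega>Q: "\<omega> ^ (q ^ 2) = \<omega>" using \<omega> by (simp add: F_q2_def card_k)
  have \<omega>1: "absval \<omega> \<le> 1"
    using absval_fixed_le_1[OF \<omega>Q] self_le_power[of q 2] q_ge_2 by simp
  have "\<omega> ^ q \<noteq> \<omega>"
    using \<omega> power_q_fixed_imp_F_q[of \<omega>] by (auto simp: F_q_def)
  define c where "c = (\<omega> - \<omega> ^ q) * quasi \<pi>\<^sub>2"
  have c: "c \<noteq> 0" using \<open>\<omega> ^ q \<noteq> \<omega>\<close> \<pi>\<^sub>2 by (simp add: c_def)
  obtain B1 where B1: "B1 > 0" "\<And>a. absval a \<le> 1 \<Longrightarrow> absval (ext_exp a \<pi>\<^sub>2) \<le> absval a * B1"
      "\<And>a. absval a \<le> 1 \<Longrightarrow> absval (ext_exp a \<pi>\<^sub>2 - a * quasi \<pi>\<^sub>2) \<le> (absval a)\<^sup>2 * B1"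
    using ext_exp_approx[of \<pi>\<^sub>2] by blast
  obtain B2 where B2: "B2 > 0" "\<And>a. absval a \<le> 1 \<Longrightarrow> absval (ext_exp a (\<omega> * \<pi>\<^sub>2)) \<le> absval a * B2"
      "\<And>a. absval a \<le> 1 \<Longrightarrow> absval (ext_exp a (\<omega> * \<pi>\<^sub>2) - a * quasi (\<omega> * \<pi>\<^sub>2)) \<le> (absval a)\<^sup>2 * B2"
    using ext_exp_approx[of "\<omega> * \<pi>\<^sub>2"] by blast
  define B where "B = max 1 (max B1 B2)"
  have B: "B \<ge> 1" "B1 \<le> B" "B2 \<le> B" by (auto simp: B_def)
  have BB: "B \<le> B\<^sup>2" using B(1) self_le_power[of B 2] by simp
  \<comment> \<open>The first bound keeps |w1| and |w2| at most 1, where the logarithm estimate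
    holds; the second makes the nonlinear part contract by 1/2.\<close>
  define r where "r = min (1 / B) (absval c / (2 * B\<^sup>2))"
  have r: "r > 0" "r \<le> 1 / B" "r \<le> absval c / (2 * B\<^sup>2)" using B c by (auto simp: r_def)
  have r1: "r \<le> 1" using r(2) B(1) by (simp add: order.trans)
  define w1 where "w1 a = - ext_exp a \<pi>\<^sub>2" for a
  define w2 where "w2 a = - ext_exp a (\<omega> * \<pi>\<^sub>2)" for a
  define F where "F a = carlitz_log (w2 a) - \<omega> * carlitz_log (w1 a)" for a
  have w: "absval (w1 a) \<le> absval a * B" "absval (w2 a) \<le> absval a * B"
      "absval (w1 a) \<le> 1" "absval (w2 a) \<le> 1" if a: "absval a \<le> r" for a
  proof -
    have a1: "absval a \<le> 1" using a r1 by linarith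
    have "absval a * B1 \<le> absval a * B" "absval a * B2 \<le> absval a * B"
      using B by (auto intro!: mult_left_mono)
    with B1(2)[OF a1] B2(2)[OF a1]
    show *: "absval (w1 a) \<le> absval a * B" "absval (w2 a) \<le> absval a * B"
      by (auto simp: w1_def w2_def)
    have "absval a * B \<le> 1 / B * B"
      using a r(2) B by (intro mult_right_mono) auto
    hence "absval a * B \<le> 1" using B by simp
    with * show "absval (w1 a) \<le> 1" "absval (w2 a) \<le> 1" by auto
  qed
  have wq: "absval (w1 a) \<le> q" "absval (w2 a) \<le> q" if "absval a \<le> r" for a
    using w(3,4)[OF that] q_ge_2 by auto
  have F_diff: "F (a - b) = F a - F b" if ab: "absval a \<le> r" "absval b \<le> r" for a b
  proof -
    have "w1 (a - b) = w1 a - w1 b" "w2 (a - b) = w2 a - w2 b"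
      using ab r1 by (auto simp: w1_def w2_def ext_exp_param_diff)
    hence "carlitz_log (w1 (a - b)) = carlitz_log (w1 a) - carlitz_log (w1 b)"
      "carlitz_log (w2 (a - b)) = carlitz_log (w2 a) - carlitz_log (w2 b)"
      using wq[OF ab(1)] wq[OF ab(2)] by (simp_all add: carlitz_log_diff)
    thus ?thesis unfolding F_def by (simp only:) (simp add: algebra_simps)
  qed
  \<comment> \<open>Four errors occur, each of order |a|^2: two from replacing logarithms by their
    arguments, two from replacing \<open>ext_exp a\<close> by its linear part.\<close>
  have F_approx: "absval (F a - c * a) \<le> (absval a)\<^sup>2 * B\<^sup>2" if a: "absval a \<le> r" for a
  proof -
    have a1: "absval a \<le> 1" using a r1 by linarith
    have le_mult: "absval (\<omega> * x) \<le> K" if "absval x \<le> K" for x K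
      using mult_right_mono[OF \<omega>1, of "absval x"] that by (simp add: absval_mult)
    let ?K = "(absval a)\<^sup>2 * B\<^sup>2"
    have K1: "(absval (w1 a))\<^sup>2 \<le> ?K" "(absval (w2 a))\<^sup>2 \<le> ?K"
      using w(1,2)[OF a] by (auto simp flip: power_mult_distrib intro!: power_mono)
    have K2: "(absval a)\<^sup>2 * B1 \<le> ?K" "(absval a)\<^sup>2 * B2 \<le> ?K"
      using B BB by (auto intro!: mult_left_mono)
    define t1 where "t1 = carlitz_log (w2 a) - w2 a"
    define t2 where "t2 = \<omega> * (carlitz_log (w1 a) - w1 a)"
    define t3 where "t3 = ext_exp a (\<omega> * \<pi>\<^sub>2) - a * quasi (\<omega> * \<pi>\<^sub>2)"
    define t4 where "t4 = \<omega> * (ext_exp a \<pi>\<^sub>2 - a * quasi \<pi>\<^sub>2)"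
    have t1: "absval t1 \<le> ?K"
      unfolding t1_def by (rule order.trans[OF carlitz_log_approx[OF w(4)[OF a]] K1(2)])
    have t2: "absval t2 \<le> ?K"
      unfolding t2_def by (rule le_mult[OF order.trans[OF carlitz_log_approx[OF w(3)[OF a]] K1(1)]])
    have t3: "absval t3 \<le> ?K"
      unfolding t3_def by (rule order.trans[OF B2(3)[OF a1] K2(2)])
    have t4: "absval t4 \<le> ?K"
      unfolding t4_def by (rule le_mult[OF order.trans[OF B1(3)[OF a1] K2(1)]])
    have eq: "F a - c * a = (t1 - t2) - (t3 - t4)"
      by (simp add: F_def c_def t1_def t2_def t3_def t4_def w1_def w2_def quasi_scale[OF \<omega>Q]
          algebra_simps)
    show ?thesis
      unfolding eq using absval_diff[of "t1 - t2" "t3 - t4"] absval_diff[of t1 t2] absval_diff[of t3 t4] t1 t2 t3 t4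
      by linarith
  qed
  \<comment> \<open>The normalised nonlinear part: F a = c (a + N a).\<close>
  define N where "N a = (F a - c * a) / c" for a
  \<comment> \<open>Chosen so that the target \<open>s * \<pi>\<^sub>1 / c\<close> lies in the ball
    of radius r.\<close>
  define \<delta> where "\<delta> = r * absval c / absval \<pi>\<^sub>1"
  have "\<exists>a x y. absval a \<le> 1 \<and> carlitz_exp 1 x = - ext_exp a \<pi>\<^sub>2 \<and>
      carlitz_exp 1 y = - ext_exp a (\<omega> * \<pi>\<^sub>2) \<and> y - \<omega> * x = s * \<pi>\<^sub>1" if s: "absval s < \<delta>" for s
  proof -
    have "\<exists>a. absval a \<le> r \<and> a + N a = s * \<pi>\<^sub>1 / c"
    proof (rule additive_contraction_solvable[of "1 / 2"])
      show "absval (s * \<pi>\<^sub>1 / c) \<le> r"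
        using s c \<pi>\<^sub>1 by (simp add: \<delta>_def absval_mult absval_divide field_simps)
      show "N (x - y) = N x - N y" if "absval x \<le> r" "absval y \<le> r" for x y
        unfolding N_def F_diff[OF that] by (simp add: diff_divide_distrib[symmetric] right_diff_distrib)
      fix a :: 'c assume a: "absval a \<le> r"
      have "absval (N a) = absval (F a - c * a) / absval c"
        by (simp add: N_def absval_divide)
      also have "\<dots> \<le> (absval a)\<^sup>2 * B\<^sup>2 / absval c"
        by (intro divide_right_mono F_approx[OF a]) simp
      also have "\<dots> = absval a * (absval a * B\<^sup>2 / absval c)"
        by (simp add: power2_eq_square)
      also have "absval a * B\<^sup>2 / absval c \<le> 1 / 2"
        using order.trans[OF a r(3)] c B(1) by (simp add: field_simps)
      hence "absval a * (absval a * B\<^sup>2 / absval c) \<le> absval a * (1 / 2)"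
        by (intro mult_left_mono) auto
      finally show "absval (N a) \<le> 1 / 2 * absval a" by simp
    qed auto
    then obtain a where a: "absval a \<le> r" "a + N a = s * \<pi>\<^sub>1 / c" by blast
    have "c * (a + N a) = F a" using c by (simp add: N_def field_simps)
    hence "F a = s * \<pi>\<^sub>1" using c by (simp add: a(2))
    thus ?thesis
      using a(1) r1 carlitz_log(2)[OF wq(1)[OF a(1)]] carlitz_log(2)[OF wq(2)[OF a(1)]]
      by (intro exI[of _ a] exI[of _ "carlitz_log (w1 a)"] exI[of _ "carlitz_log (w2 a)"])
        (auto simp: F_def w1_def w2_def)
  qed
  moreover have "\<delta> > 0" using r(1) c \<pi>\<^sub>1 by (simp add: \<delta>_def)
  ultimately show ?thesis by blast
qed

end

subsection \<open>The exponential of the extension and its kernel\<close>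

lemma sums_vec_iff:
  fixes f :: "nat \<Rightarrow> 'a::{topological_space,comm_monoid_add}^'n"
  shows "f sums s \<longleftrightarrow> (\<forall>i. (\<lambda>n. f n $ i) sums (s $ i))"
proof
  assume "f sums s"
  thus "\<forall>i. (\<lambda>n. f n $ i) sums (s $ i)"
    unfolding sums_def by (auto dest: tendsto_vec_nth)
next
  assume "\<forall>i. (\<lambda>n. f n $ i) sums (s $ i)"
  thus "f sums s"
    unfolding sums_def by (auto intro: vec_tendstoI)
qed

text \<open>The matrices of \<open>theorem3p4\<close> with \<open>a\<^sub>1\<^sub>1 = a\<^sub>1\<^sub>2 = 0\<close> and \<open>a\<^sub>2\<^sub>1 = a\<close>.\<close>

definition ext_matrices :: "'c::field \<Rightarrow> ('c^2^2) list" where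
  "ext_matrices a = [vector [vector [0, 0], vector [a, 1]], vector [vector [1, 0], vector [0, 0]]]"

context C_infty_card
begin

lemma T_map_ext_matrices:
  "T_map \<iota> (ext_matrices a) Z $ 1 = \<theta> * Z $ 1 + (Z $ 1) ^ (q ^ 2)"
  "T_map \<iota> (ext_matrices a) Z $ 2 = \<theta> * Z $ 2 + a * (Z $ 1) ^ q + (Z $ 2) ^ q"
  by (simp_all add: T_map_def ext_matrices_def matrix_vector_mult_def sum_2 frob_def card_k
      numeral_2_eq_2 lessThan_Suc power2_eq_square add_ac)

text \<open>Evaluation on a coordinate axis isolates one column of the coefficients and reduces
  vector series to scalar ones.\<close>

lemma matrix_frob_axis:
  "(C *v frob q i (axis j z)) $ l = C $ l $ j * (z :: 'c) ^ (q ^ i)"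
proof -
  have "(C *v frob q i (axis j z)) $ l = (\<Sum>m\<in>UNIV. if m = j then C $ l $ j * z ^ (q ^ i) else 0)"
    unfolding matrix_vector_mult_def vec_lambda_beta
    by (rule sum.cong) (auto simp: frob_def axis_def zero_power)
  thus ?thesis by simp
qed

text \<open>At i = 0 the factor \<open>\<theta> ^ (q ^ i) - \<theta>\<close> vanishes, so the value
  there has to be prescribed; at later indices it can be cancelled.\<close>

lemma qseries_rec_unique:
  fixes u v :: "nat \<Rightarrow> 'c"
  assumes "u 0 = v 0" "\<And>i. i > 0 \<Longrightarrow> (\<And>j. j < i \<Longrightarrow> u j = v j) \<Longrightarrow>
    u i * (\<theta> ^ (q ^ i) - \<theta>) = v i * (\<theta> ^ (q ^ i) - \<theta>)"
  shows "u i = v i"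
proof (induction i rule: less_induct)
  case (less i)
  show ?case
  proof (cases "i = 0")
    case False
    thus ?thesis using assms(2)[of i] less.IH theta_power_diff_nonzero[of i] by simp
  qed (use assms(1) in simp)
qed

text \<open>On each axis the functional equation becomes a vanishing scalar series, and
  \<open>qseries_identity\<close> reads off its coefficients.\<close>

lemma exp_map_coeff_rec:
  fixes f :: "'c^2 \<Rightarrow> 'c^2" and C :: "nat \<Rightarrow> 'c^2^2"
  assumes C: "\<And>Z. (\<lambda>i. C i *v frob q i Z) sums f Z"
    and f: "\<And>Z. f (\<theta> *s Z) = T_map \<iota> (ext_matrices a) (f Z)"
  shows "C i $ 1 $ j * (\<theta> ^ (q ^ i) - \<theta>) = (if i < 2 then 0 else (C (i - 2) $ 1 $ j) ^ (q ^ 2))"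
    and "C i $ 2 $ j * (\<theta> ^ (q ^ i) - \<theta>) = (if i < 1 then 0 else (C (i - 1) $ 2 $ j) ^ (q ^ 1)) +
      a * (if i < 1 then 0 else (C (i - 1) $ 1 $ j) ^ (q ^ 1))"
proof -
  let ?s = "\<lambda>k u i. if i < k then 0 else u (i - k) ^ (q ^ k) :: 'c"
  define F where "F l z = f (axis j z) $ l" for l z
  have F: "(\<lambda>i. C i $ l $ j * z ^ (q ^ i)) sums F l z" for l z
    using C[of "axis j z"] by (simp add: sums_vec_iff matrix_frob_axis F_def)
  have ax: "\<theta> *s axis j z = axis j (\<theta> * z)" for z
    by (simp add: vec_eq_iff axis_def)
  have F1: "F 1 (\<theta> * z) = \<theta> * F 1 z + F 1 z ^ (q ^ 2)" for z
    using f[of "axis j z"] by (simp add: F_def ax T_map_ext_matrices)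
  have F2: "F 2 (\<theta> * z) = \<theta> * F 2 z + a * F 1 z ^ (q ^ 1) + F 2 z ^ (q ^ 1)" for z
    using f[of "axis j z"] by (simp add: F_def ax T_map_ext_matrices)
  have "(\<lambda>i. (C i $ 1 $ j * (\<theta> ^ (q ^ i) - \<theta>) - ?s 2 (\<lambda>i. C i $ 1 $ j) i) * z ^ (q ^ i)) sums 0" for z
  proof -
    have "(\<lambda>i. C i $ 1 $ j * (\<theta> * z) ^ (q ^ i) - \<theta> * (C i $ 1 $ j * z ^ (q ^ i)) -
        ?s 2 (\<lambda>i. C i $ 1 $ j) i * z ^ (q ^ i)) sums (F 1 (\<theta> * z) - \<theta> * F 1 z - F 1 z ^ (q ^ 2))"
      by (intro sums_diff_field sums_mult_field qseries_shift_power F)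
    also have "(\<lambda>i. C i $ 1 $ j * (\<theta> * z) ^ (q ^ i) - \<theta> * (C i $ 1 $ j * z ^ (q ^ i)) -
        ?s 2 (\<lambda>i. C i $ 1 $ j) i * z ^ (q ^ i)) =
        (\<lambda>i. (C i $ 1 $ j * (\<theta> ^ (q ^ i) - \<theta>) - ?s 2 (\<lambda>i. C i $ 1 $ j) i) * z ^ (q ^ i))"
      by (rule ext) (simp only: power_mult_distrib algebra_simps)
    finally show ?thesis by (simp only: F1) simp
  qed
  from qseries_identity[OF this, of i]
  show "C i $ 1 $ j * (\<theta> ^ (q ^ i) - \<theta>) = ?s 2 (\<lambda>i. C i $ 1 $ j) i" by simp
  have "(\<lambda>i. (C i $ 2 $ j * (\<theta> ^ (q ^ i) - \<theta>) - (?s 1 (\<lambda>i. C i $ 2 $ j) i +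
      a * ?s 1 (\<lambda>i. C i $ 1 $ j) i)) * z ^ (q ^ i)) sums 0" for z
  proof -
    have "(\<lambda>i. C i $ 2 $ j * (\<theta> * z) ^ (q ^ i) - \<theta> * (C i $ 2 $ j * z ^ (q ^ i)) -
        ?s 1 (\<lambda>i. C i $ 2 $ j) i * z ^ (q ^ i) - a * (?s 1 (\<lambda>i. C i $ 1 $ j) i * z ^ (q ^ i)))
        sums (F 2 (\<theta> * z) - \<theta> * F 2 z - F 2 z ^ (q ^ 1) - a * F 1 z ^ (q ^ 1))"
      by (intro sums_diff_field sums_mult_field qseries_shift_power F)
    also have "(\<lambda>i. C i $ 2 $ j * (\<theta> * z) ^ (q ^ i) - \<theta> * (C i $ 2 $ j * z ^ (q ^ i)) -
        ?s 1 (\<lambda>i. C i $ 2 $ j) i * z ^ (q ^ i) - a * (?s 1 (\<lambda>i. C i $ 1 $ j) i * z ^ (q ^ i))) =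
        (\<lambda>i. (C i $ 2 $ j * (\<theta> ^ (q ^ i) - \<theta>) - (?s 1 (\<lambda>i. C i $ 2 $ j) i +
        a * ?s 1 (\<lambda>i. C i $ 1 $ j) i)) * z ^ (q ^ i))"
      by (rule ext) (simp only: power_mult_distrib algebra_simps)
    finally show ?thesis by (simp only: F2) simp
  qed
  from qseries_identity[OF this, of i]
  show "C i $ 2 $ j * (\<theta> ^ (q ^ i) - \<theta>) = ?s 1 (\<lambda>i. C i $ 2 $ j) i + a * ?s 1 (\<lambda>i. C i $ 1 $ j) i"
    by simp
qed

lemma exp_map_unique:
  fixes f g :: "'c^2 \<Rightarrow> 'c^2"
  assumes C: "C 0 = mat 1" "\<And>Z. (\<lambda>i. C i *v frob q i Z) sums f Z"
    and f: "\<And>Z. f (\<theta> *s Z) = T_map \<iota> (ext_matrices a) (f Z)"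
    and D: "D 0 = mat 1" "\<And>Z. (\<lambda>i. D i *v frob q i Z) sums g Z"
    and g: "\<And>Z. g (\<theta> *s Z) = T_map \<iota> (ext_matrices a) (g Z)"
  shows "f = g"
proof -
  note rC = exp_map_coeff_rec[OF C(2) f] and rD = exp_map_coeff_rec[OF D(2) g]
  have 1: "C i $ 1 $ j = D i $ 1 $ j" for i j
  proof (rule qseries_rec_unique[of "\<lambda>i. C i $ 1 $ j" "\<lambda>i. D i $ 1 $ j"])
    show "C 0 $ 1 $ j = D 0 $ 1 $ j" by (simp only: C(1) D(1))
    fix i assume "\<And>m. m < i \<Longrightarrow> C m $ 1 $ j = D m $ 1 $ j"
    thus "C i $ 1 $ j * (\<theta> ^ (q ^ i) - \<theta>) = D i $ 1 $ j * (\<theta> ^ (q ^ i) - \<theta>)"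
      unfolding rC rD by simp
  qed
  \<comment> \<open>The recursion for row 2 contains row 1, so row 1 has to be settled
    before.\<close>
  have 2: "C i $ 2 $ j = D i $ 2 $ j" for i j
  proof (rule qseries_rec_unique[of "\<lambda>i. C i $ 2 $ j" "\<lambda>i. D i $ 2 $ j"])
    show "C 0 $ 2 $ j = D 0 $ 2 $ j" by (simp only: C(1) D(1))
    fix i assume "\<And>m. m < i \<Longrightarrow> C m $ 2 $ j = D m $ 2 $ j"
    thus "C i $ 2 $ j * (\<theta> ^ (q ^ i) - \<theta>) = D i $ 2 $ j * (\<theta> ^ (q ^ i) - \<theta>)"
      unfolding rC rD 1 by simp
  qed
  have "C i = D i" for i
    using 1 2 by (simp add: vec_eq_iff forall_2)
  hence "C = D" by (rule ext)
  show ?thesis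
  proof
    fix Z show "f Z = g Z"
      using sums_unique2[OF C(2)[of Z]] D(2)[of Z] unfolding \<open>C = D\<close> by blast
  qed
qed

lemma exp_map_ext_matrices:
  assumes a: "absval a \<le> 1"
  shows "exp_map \<iota> (ext_matrices a) =
    (\<lambda>Z. vector [carlitz_exp 2 (Z $ 1), carlitz_exp 1 (Z $ 2) + ext_exp a (Z $ 1)])"
    (is "_ = ?f")
  unfolding exp_map_def card_k[symmetric]
proof (rule the_equality)
  define C :: "nat \<Rightarrow> 'c^2^2" where
    "C i = vector [vector [exp_coeff 2 i, 0], vector [ext_coeff a i, exp_coeff 1 i]]" for i
  have C: "C 0 = mat 1" "\<And>Z. (\<lambda>i. C i *v frob q i Z) sums ?f Z"
  proof -
    show "C 0 = mat 1" by (simp add: C_def mat_def vec_eq_iff forall_2)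
    fix Z :: "'c^2"
    have 1: "(C i *v frob q i Z) $ 1 = exp_coeff 2 i * (Z $ 1) ^ (q ^ i)" for i
      by (simp add: C_def matrix_vector_mult_def sum_2 frob_def)
    have 2: "(C i *v frob q i Z) $ 2 =
        exp_coeff 1 i * (Z $ 2) ^ (q ^ i) + ext_coeff a i * (Z $ 1) ^ (q ^ i)" for i
      by (simp add: C_def matrix_vector_mult_def sum_2 frob_def)
    show "(\<lambda>i. C i *v frob q i Z) sums ?f Z"
      unfolding sums_vec_iff forall_2 1 2
      using carlitz_exp_sums[of 2 "Z $ 1"]
        sums_add_field[OF carlitz_exp_sums[of 1 "Z $ 2"] ext_exp_sums[OF a, of "Z $ 1"]]
      by simp
  qed
  have f: "?f (\<theta> *s Z) = T_map \<iota> (ext_matrices a) (?f Z)" for Z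
    by (simp add: vec_eq_iff forall_2 T_map_ext_matrices carlitz_exp_theta ext_exp_theta[OF a]
        add_power_q algebra_simps)
  show "(\<exists>C. C 0 = mat 1 \<and> (\<forall>Z. (\<lambda>i. C i *v frob q i Z) sums ?f Z)) \<and>
      (\<forall>Z. ?f (\<theta> *s Z) = T_map \<iota> (ext_matrices a) (?f Z))"
    using C f by blast
  fix g assume g: "(\<exists>C. C 0 = mat 1 \<and> (\<forall>Z. (\<lambda>i. C i *v frob q i Z) sums g Z)) \<and>
      (\<forall>Z. g (\<theta> *s Z) = T_map \<iota> (ext_matrices a) (g Z))"
  then obtain D where D: "D 0 = mat 1" "\<And>Z. (\<lambda>i. D i *v frob q i Z) sums g Z" by blast
  show "g = ?f"
    by (rule exp_map_unique[OF D _ C f]) (use g in blast)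
qed

lemma mem_L_module_iff:
  assumes "absval a \<le> 1"
  shows "Z \<in> L_module \<iota> (ext_matrices a) \<longleftrightarrow>
    carlitz_exp 2 (Z $ 1) = 0 \<and> carlitz_exp 1 (Z $ 2) + ext_exp a (Z $ 1) = 0"
  by (simp add: L_module_def exp_map_ext_matrices[OF assms] vec_eq_iff forall_2)

section \<open>The kernel as a lattice over F_q[\<theta>]\<close>

definition embed_A :: "'k poly \<Rightarrow> 'c" where
  "embed_A p = \<iota> (poly (map_poly fls_const p) fls_X_inv)"

lemma A_scale_eq: "A_scale \<iota> p v = embed_A p *s v"
  by (simp add: A_scale_def R_scale_def embed_A_def)

lemma embed_A_0 [simp]: "embed_A 0 = 0"
  by (simp add: embed_A_def embed_zero)

lemma embed_A_pCons: "embed_A (pCons c p) = \<iota> (fls_const c) + \<theta> * embed_A p"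
  by (simp add: embed_A_def map_poly_pCons embed_add embed_mult theta_def)

lemma embed_A_eq_0_iff: "embed_A p = 0 \<longleftrightarrow> p = 0"
  by (simp add: embed_A_def embed_eq_0_iff poly_at_theta_eq_0_iff)

text \<open>The kernel is stable under constants and under \<theta>; Horner induction extends this
  to all polynomials.\<close>

lemma subspace_L_module:
  assumes a: "absval a \<le> 1"
  shows "module.subspace (A_scale \<iota>) (L_module \<iota> (ext_matrices a))"
proof -
  interpret A: module "A_scale \<iota> :: _ \<Rightarrow> 'c^2 \<Rightarrow> _" by (rule module_A_scale)
  let ?L = "L_module \<iota> (ext_matrices a)"
  have add: "v + w \<in> ?L" if "v \<in> ?L" "w \<in> ?L" for v w
  proof -
    have "carlitz_exp 1 (v $ 2 + w $ 2) + ext_exp a (v $ 1 + w $ 1) =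
        (carlitz_exp 1 (v $ 2) + ext_exp a (v $ 1)) + (carlitz_exp 1 (w $ 2) + ext_exp a (w $ 1))"
      by (simp add: carlitz_exp_add ext_exp_add[OF a])
    thus ?thesis
      using that unfolding mem_L_module_iff[OF a] vector_add_component
      by (simp only:) (simp add: carlitz_exp_add)
  qed
  have scale: "\<iota> (fls_const c) *s v \<in> ?L" if "v \<in> ?L" for c v
  proof -
    let ?c = "\<iota> (fls_const c)"
    have c: "?c ^ q = ?c" "?c ^ (q ^ 1) = ?c" "?c ^ (q ^ 2) = ?c"
      using power_q_power_fixed[of ?c 1 2] embed_const_power_q[of c] by auto
    have "carlitz_exp 1 (?c * v $ 2) + ext_exp a (?c * v $ 1) =
        ?c * (carlitz_exp 1 (v $ 2) + ext_exp a (v $ 1))"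
      using carlitz_exp_scale[OF _ c(2)] ext_exp_scale[OF a c(1)] by (simp add: distrib_left)
    thus ?thesis using that carlitz_exp_scale[OF _ c(3)] by (simp add: mem_L_module_iff[OF a])
  qed
  have theta: "\<theta> *s v \<in> ?L" if v: "v \<in> ?L" for v
  proof -
    have e: "carlitz_exp 2 (v $ 1) = 0" "carlitz_exp 1 (v $ 2) = - ext_exp a (v $ 1)"
      using v by (auto simp: mem_L_module_iff[OF a] eq_neg_iff_add_eq_0)
    thus ?thesis
      using minus_power_q_power[of "ext_exp a (v $ 1)" 1]
      by (simp add: mem_L_module_iff[OF a] carlitz_exp_theta ext_exp_theta[OF a] zero_power)
  qed
  have "A_scale \<iota> p v \<in> ?L" if v: "v \<in> ?L" for p v
  proof (induction p)
    case 0
    show ?case by (simp add: A_scale_eq mem_L_module_iff[OF a])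
  next
    case (pCons c p)
    have "A_scale \<iota> (pCons c p) v = \<iota> (fls_const c) *s v + \<theta> *s A_scale \<iota> p v"
      by (simp add: A_scale_eq embed_A_pCons vec_eq_iff algebra_simps)
    thus ?case using add[OF scale[OF v] theta[OF pCons.IH]] by simp
  qed
  moreover have "0 \<in> ?L" by (simp add: mem_L_module_iff[OF a])
  ultimately show ?thesis using add by (intro A.subspaceI) auto
qed

lemma period_span_1_imp:
  assumes "period_span 1 \<pi> x"
  shows "\<exists>p. x = embed_A p * \<pi>"
  using assms
proof induction
  case zero
  show ?case by (intro exI[of _ 0]) simp
next
  case (step c x)
  then obtain p where p: "x = embed_A p * \<pi>" by blast
  obtain d where "c = \<iota> (fls_const d)" using power_q_fixed_imp_F_q[of c] step.hyps by auto
  thus ?case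
    by (intro exI[of _ "pCons d p"]) (simp add: p embed_A_pCons algebra_simps)
qed

lemma period_span_2_imp:
  assumes \<omega>: "\<omega> \<in> F_q2 \<iota> - F_q \<iota>" and "period_span 2 \<pi> x"
  shows "\<exists>p r. x = embed_A p * \<pi> + embed_A r * (\<omega> * \<pi>)"
  using assms(2)
proof induction
  case zero
  show ?case by (intro exI[of _ 0]) simp
next
  case (step c x)
  then obtain p r where p: "x = embed_A p * \<pi> + embed_A r * (\<omega> * \<pi>)" by blast
  obtain d e where "c = \<iota> (fls_const d) + \<omega> * \<iota> (fls_const e)"
    using power_q2_fixed_imp_F_q2[OF \<omega> step.hyps(1)] by blast
  thus ?case
    by (intro exI[of _ "pCons d p"] exI[of _ "pCons e r"]) (simp add: p embed_A_pCons algebra_simps)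
qed

text \<open>The first coordinate of a kernel element is a period of the quadratic exponential.
  Subtracting a combination of the second and third generators makes it 0, and then the second
  coordinate is a Carlitz period.\<close>

lemma L_module_explicit:
  assumes \<omega>: "\<omega> \<in> F_q2 \<iota> - F_q \<iota>" and a: "absval a \<le> 1"
    and \<pi>\<^sub>1: "carlitz_exp 1 \<pi>\<^sub>1 = 0" "\<And>x. carlitz_exp 1 x = 0 \<Longrightarrow> period_span 1 \<pi>\<^sub>1 x"
    and \<pi>\<^sub>2: "carlitz_exp 2 \<pi>\<^sub>2 = 0" "\<And>x. carlitz_exp 2 x = 0 \<Longrightarrow> period_span 2 \<pi>\<^sub>2 x"
    and x: "carlitz_exp 1 x = - ext_exp a \<pi>\<^sub>2" and y: "carlitz_exp 1 y = - ext_exp a (\<omega> * \<pi>\<^sub>2)"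
  shows "L_module \<iota> (ext_matrices a) =
    module.span (A_scale \<iota>) {vector [0, \<pi>\<^sub>1], vector [\<pi>\<^sub>2, x], vector [\<omega> * \<pi>\<^sub>2, y]}"
proof -
  interpret A: module "A_scale \<iota> :: _ \<Rightarrow> 'c^2 \<Rightarrow> _" by (rule module_A_scale)
  let ?L = "L_module \<iota> (ext_matrices a)"
  define l1 l2 l3 :: "'c^2" where
    "l1 = vector [0, \<pi>\<^sub>1]" and "l2 = vector [\<pi>\<^sub>2, x]" and "l3 = vector [\<omega> * \<pi>\<^sub>2, y]"
  note sub = subspace_L_module[OF a]
  have "\<omega> ^ (q ^ 2) = \<omega>" using \<omega> by (simp add: F_q2_def card_k)
  hence l: "l1 \<in> ?L" "l2 \<in> ?L" "l3 \<in> ?L"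
    using \<pi>\<^sub>1(1) \<pi>\<^sub>2(1) x y
    by (simp_all add: mem_L_module_iff[OF a] l1_def l2_def l3_def carlitz_exp_scale)
  have "?L \<subseteq> A.span {l1, l2, l3}"
  proof
    fix Z assume Z: "Z \<in> ?L"
    obtain p r where pr: "Z $ 1 = embed_A p * \<pi>\<^sub>2 + embed_A r * (\<omega> * \<pi>\<^sub>2)"
      using period_span_2_imp[OF \<omega> \<pi>\<^sub>2(2)[of "Z $ 1"]] Z by (auto simp: mem_L_module_iff[OF a])
    define W where "W = Z - A_scale \<iota> p l2 - A_scale \<iota> r l3"
    have W: "W \<in> ?L"
      unfolding W_def by (intro A.subspace_diff[OF sub] A.subspace_scale[OF sub] Z l)
    have W1: "W $ 1 = 0" by (simp add: W_def A_scale_eq l2_def l3_def pr)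
    have "carlitz_exp 1 (W $ 2) = 0" using W by (simp add: mem_L_module_iff[OF a] W1)
    then obtain d where d: "W $ 2 = embed_A d * \<pi>\<^sub>1"
      using period_span_1_imp[OF \<pi>\<^sub>1(2)] by blast
    have "W = A_scale \<iota> d l1"
      using W1 d by (simp add: vec_eq_iff forall_2 A_scale_eq l1_def)
    hence "Z = A_scale \<iota> d l1 + A_scale \<iota> p l2 + A_scale \<iota> r l3"
      by (simp add: W_def algebra_simps)
    also have "\<dots> \<in> A.span {l1, l2, l3}"
      by (intro A.span_add A.span_scale A.span_base) auto
    finally show "Z \<in> A.span {l1, l2, l3}" .
  qed
  moreover have "A.span {l1, l2, l3} \<subseteq> ?L"
    using l by (intro A.span_minimal[OF _ sub]) auto
  ultimately show ?thesis by (simp add: l1_def l2_def l3_def)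
qed

end

subsection \<open>Ranks and isomorphisms of lattices\<close>

text \<open>Elimination without division, so that it applies to the polynomial ring acting on
  lattices.\<close>

lemma homogeneous_system_nontrivial_solution:
  fixes v :: "'i \<Rightarrow> nat \<Rightarrow> 'a::idom"
  assumes "finite I" "card I > n"
  shows "\<exists>u. (\<exists>i\<in>I. u i \<noteq> 0) \<and> (\<forall>j<n. (\<Sum>i\<in>I. u i * v i j) = 0)"
  using assms
proof (induction n arbitrary: I v)
  case 0
  hence "I \<noteq> {}" by auto
  thus ?case by (intro exI[of _ "\<lambda>_. 1"]) auto
next
  case (Suc n)
  show ?case
  proof (cases "\<forall>i\<in>I. v i n = 0")
    case True
    obtain u where "\<exists>i\<in>I. u i \<noteq> 0" "\<forall>j<n. (\<Sum>i\<in>I. u i * v i j) = 0"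
      using Suc.IH[of I v] Suc.prems by auto
    thus ?thesis using True by (intro exI[of _ u]) (auto simp: less_Suc_eq)
  next
    case False
    then obtain k where k: "k \<in> I" "v k n \<noteq> 0" by blast
    define J where "J = I - {k}"
    have J: "finite J" "k \<notin> J" "I = insert k J" "card J > n"
      using k Suc.prems by (auto simp: J_def card_Diff_singleton)
    obtain u where u: "\<exists>i\<in>J. u i \<noteq> 0"
        "\<And>j. j < n \<Longrightarrow> (\<Sum>i\<in>J. u i * (v k n * v i j - v i n * v k j)) = 0"
      using Suc.IH[OF J(1,4), of "\<lambda>i j. v k n * v i j - v i n * v k j"] by auto
    \<comment> \<open>The value at k solves equation n; the others are multiplied by the pivot,
      which keeps them nonzero in a domain.\<close>
    define w where "w i = (if i = k then - (\<Sum>i\<in>J. u i * v i n) else v k n * u i)" for i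
    have sum_w: "(\<Sum>i\<in>I. w i * v i j) = (\<Sum>i\<in>J. u i * (v k n * v i j - v i n * v k j))" for j
    proof -
      have "(\<Sum>i\<in>I. w i * v i j) = w k * v k j + (\<Sum>i\<in>J. w i * v i j)"
        using J by simp
      also have "(\<Sum>i\<in>J. w i * v i j) = (\<Sum>i\<in>J. v k n * u i * v i j)"
        using J by (intro sum.cong) (auto simp: w_def)
      also have "w k * v k j + \<dots> = (\<Sum>i\<in>J. u i * (v k n * v i j - v i n * v k j))"
        by (simp add: w_def right_diff_distrib sum_subtractf sum_distrib_right sum_distrib_left mult_ac)
      finally show ?thesis .
    qed
    have "(\<Sum>i\<in>I. w i * v i j) = 0" if "j < Suc n" for j
    proof (cases "j = n")
      case True
      thus ?thesis unfolding sum_w by (simp add: mult.commute)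
    next
      case False
      thus ?thesis unfolding sum_w using that u(2)[of j] by simp
    qed
    moreover have "\<exists>i\<in>I. w i \<noteq> 0" using u(1) J k by (auto simp: w_def)
    ultimately show ?thesis by blast
  qed
qed

context C_infty_card
begin

text \<open>For n + 1 elements of the span, a relation amounts to n homogeneous equations in n + 1
  unknowns, which have a nontrivial solution.\<close>

lemma A_rank_span:
  fixes B :: "('c^'n) set"
  assumes B: "finite B" "card B = n" "\<not> module.dependent (A_scale \<iota>) B"
  shows "A_rank \<iota> (module.span (A_scale \<iota>) B) n"
proof -
  interpret A: module "A_scale \<iota> :: _ \<Rightarrow> 'c^'n \<Rightarrow> _" by (rule module_A_scale)
  have "finite S \<and> card S \<le> n" if S: "S \<subseteq> A.span B" "\<not> A.dependent S" for S
  proof (rule ccontr)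
    assume *: "\<not> (finite S \<and> card S \<le> n)"
    obtain I where I: "finite I" "I \<subseteq> S" "card I = Suc n"
    proof (cases "finite S")
      case True
      then obtain I where "I \<subseteq> S" "card I = Suc n" "finite I"
        using * obtain_subset_with_card_n[of "Suc n" S] by auto
      thus ?thesis using that by blast
    next
      case False
      thus ?thesis using infinite_arbitrarily_large[of S "Suc n"] that by blast
    qed
    have "\<exists>c. w = (\<Sum>b\<in>B. A_scale \<iota> (c b) b)" if "w \<in> I" for w
      using that I(2) S(1) A.span_finite[OF B(1)] by auto
    then obtain c where c: "\<And>w. w \<in> I \<Longrightarrow> w = (\<Sum>b\<in>B. A_scale \<iota> (c w b) b)" by metis
    obtain f where f: "bij_betw f {..<n} B"
      using ex_bij_betw_nat_finite[OF B(1)] B(2) by (auto simp: atLeast0LessThan)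
    obtain u where u: "\<exists>w\<in>I. u w \<noteq> 0" "\<And>j. j < n \<Longrightarrow> (\<Sum>w\<in>I. u w * c w (f j)) = 0"
      using homogeneous_system_nontrivial_solution[OF I(1), of n "\<lambda>w j. c w (f j)"] I(3) by auto
    have u': "(\<Sum>w\<in>I. u w * c w b) = 0" if b: "b \<in> B" for b
    proof -
      obtain j where "j < n" "f j = b" using f b unfolding bij_betw_def by auto
      thus ?thesis using u(2)[of j] by simp
    qed
    have "(\<Sum>w\<in>I. A_scale \<iota> (u w) w) = (\<Sum>w\<in>I. A_scale \<iota> (u w) (\<Sum>b\<in>B. A_scale \<iota> (c w b) b))"
      using c by (intro sum.cong) (auto simp flip: c)
    also have "\<dots> = (\<Sum>w\<in>I. \<Sum>b\<in>B. A_scale \<iota> (u w * c w b) b)"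
      by (simp only: A.scale_sum_right A.scale_scale)
    also have "\<dots> = (\<Sum>b\<in>B. A_scale \<iota> (\<Sum>w\<in>I. u w * c w b) b)"
      by (subst sum.swap) (simp only: A.scale_sum_left)
    also have "\<dots> = 0" using u' by (simp add: A.scale_zero_left)
    finally have "A.dependent S"
      unfolding A.dependent_explicit using I u(1) by blast
    thus False using S(2) by simp
  qed
  thus ?thesis unfolding A_rank_def using B A.span_superset[of B] by blast
qed

text \<open>The first coordinate gives p2 + p3 \<omega> = 0, which forces p2 = p3 = 0 as \<omega> is
  not in the image of \<iota>; the second then gives p1 = 0.\<close>

lemma period_vectors_independent:
  assumes \<omega>: "\<omega> \<in> F_q2 \<iota> - F_q \<iota>" and \<pi>: "\<pi>\<^sub>1 \<noteq> 0" "\<pi>\<^sub>2 \<noteq> 0"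
  shows "card {vector [0, \<pi>\<^sub>1], vector [\<pi>\<^sub>2, x], vector [\<omega> * \<pi>\<^sub>2, y] :: 'c^2} = 3"
    and "\<not> module.dependent (A_scale \<iota>) {vector [0, \<pi>\<^sub>1], vector [\<pi>\<^sub>2, x], vector [\<omega> * \<pi>\<^sub>2, y] :: 'c^2}"
proof -
  interpret A: module "A_scale \<iota> :: _ \<Rightarrow> 'c^2 \<Rightarrow> _" by (rule module_A_scale)
  define l1 l2 l3 :: "'c^2" where
    "l1 = vector [0, \<pi>\<^sub>1]" and "l2 = vector [\<pi>\<^sub>2, x]" and "l3 = vector [\<omega> * \<pi>\<^sub>2, y]"
  have "\<omega> \<noteq> 0" "\<omega> \<noteq> 1" using F_q2_not_embed[OF \<omega>] embed_zero embed_one by metis+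
  hence "l1 $ 1 \<noteq> l2 $ 1" "l1 $ 1 \<noteq> l3 $ 1" "l2 $ 1 \<noteq> l3 $ 1"
    using \<pi> by (simp_all add: l1_def l2_def l3_def)
  hence neq: "l1 \<noteq> l2" "l1 \<noteq> l3" "l2 \<noteq> l3" by auto
  thus "card {vector [0, \<pi>\<^sub>1], vector [\<pi>\<^sub>2, x], vector [\<omega> * \<pi>\<^sub>2, y] :: 'c^2} = 3"
    by (simp flip: l1_def l2_def l3_def)
  have lin: "p1 = 0 \<and> p2 = 0 \<and> p3 = 0"
    if "A_scale \<iota> p1 l1 + (A_scale \<iota> p2 l2 + A_scale \<iota> p3 l3) = 0" for p1 p2 p3
  proof -
    have 1: "embed_A p2 * \<pi>\<^sub>2 + embed_A p3 * (\<omega> * \<pi>\<^sub>2) = 0"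
      and 2: "embed_A p1 * \<pi>\<^sub>1 + (embed_A p2 * x + embed_A p3 * y) = 0"
      using that by (simp_all add: A_scale_eq l1_def l2_def l3_def vec_eq_iff forall_2)
    have "(embed_A p2 + embed_A p3 * \<omega>) * \<pi>\<^sub>2 = 0" using 1 by (simp add: algebra_simps)
    hence eq: "embed_A p2 + embed_A p3 * \<omega> = 0" using \<pi> by simp
    have "p3 = 0"
    proof (rule ccontr)
      assume "p3 \<noteq> 0"
      define f where "f p = poly (map_poly fls_const p) (fls_X_inv :: 'k fls)" for p
      have f: "embed_A p = \<iota> (f p)" for p by (simp add: f_def embed_A_def)
      have f3: "f p3 \<noteq> 0" using \<open>p3 \<noteq> 0\<close> by (simp add: f_def poly_at_theta_eq_0_iff)
      have "\<iota> (f p3) * \<omega> = - \<iota> (f p2)" using eq by (simp add: f eq_neg_iff_add_eq_0 add.commute)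
      also have "\<dots> = \<iota> (f p3) * \<iota> (- f p2 / f p3)"
        using f3 by (simp add: embed_minus flip: embed_mult)
      finally have "\<omega> = \<iota> (- f p2 / f p3)" using f3 by (simp add: embed_eq_0_iff)
      thus False using F_q2_not_embed[OF \<omega>] by blast
    qed
    moreover from this eq have "p2 = 0" by (simp add: embed_A_eq_0_iff)
    ultimately show ?thesis using 2 \<pi> by (simp add: embed_A_eq_0_iff)
  qed
  have "\<not> A.dependent {l1, l2, l3}"
  proof
    assume "A.dependent {l1, l2, l3}"
    then obtain u where nz: "\<exists>v\<in>{l1, l2, l3}. u v \<noteq> 0"
        and "(\<Sum>v\<in>{l1, l2, l3}. A_scale \<iota> (u v) v) = 0"
      by (auto simp: A.dependent_finite)
    hence "A_scale \<iota> (u l1) l1 + (A_scale \<iota> (u l2) l2 + A_scale \<iota> (u l3) l3) = 0"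
      using neq by simp
    from lin[OF this] nz show False by auto
  qed
  thus "\<not> A.dependent {vector [0, \<pi>\<^sub>1], vector [\<pi>\<^sub>2, x], vector [\<omega> * \<pi>\<^sub>2, y] :: 'c^2}"
    by (simp add: l1_def l2_def l3_def)
qed

lemma period_lattice_isomorphic:
  fixes L :: "('c^2) set"
  assumes \<pi>: "\<pi>\<^sub>1 \<noteq> 0" "\<pi>\<^sub>2 \<noteq> 0" and s: "y - \<omega> * x = s * \<pi>\<^sub>1"
    and L: "has_siegel_matrix \<iota> L (vector [vector [s, \<omega>]] :: 'c^2^1)"
  shows "lattice_isomorphic
    (module.span (A_scale \<iota>) {vector [0, \<pi>\<^sub>1], vector [\<pi>\<^sub>2, x], vector [\<omega> * \<pi>\<^sub>2, y] :: 'c^2}) L"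
proof -
  interpret A: module "A_scale \<iota> :: _ \<Rightarrow> 'c^2 \<Rightarrow> _" by (rule module_A_scale)
  obtain l :: "2 \<Rightarrow> 'c^2" and l' :: "1 \<Rightarrow> 'c^2" where
    span: "A.span (range (case_sum l l')) = L" and basis: "vec.span (range l) = UNIV"
    and l': "\<And>i. l' i = (\<Sum>j\<in>UNIV. (vector [vector [s, \<omega>]] :: 'c^2^1) $ i $ j *s l j)"
    using L unfolding has_siegel_matrix_def by blast
  have range_l: "range l = {l 1, l 2}" by (auto simp: UNIV_2)
  have range: "range (case_sum l l') = {l 1, l 2, l' 1}"
    using range_l by (simp add: UNIV_sum image_Un image_image) blast
  have "(vector [vector [s, \<omega>]] :: 'c^2^1) $ 1 = vector [s, \<omega>]" by (rule vector_1)
  hence l'1: "l' 1 = s *s l 1 + \<omega> *s l 2" by (simp add: l' sum_2)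
  \<comment> \<open>The two scalars are the coordinates of Z along
    \<open>vector [\<pi>\<^sub>2, x]\<close> and \<open>vector [0, \<pi>\<^sub>1]\<close>. In them
    the third generator is (\<omega>, s), just like \<open>l' 1\<close> in terms of
    \<open>l 2\<close> and \<open>l 1\<close>.\<close>
  define \<phi> :: "'c^2 \<Rightarrow> 'c^2" where
    "\<phi> Z = (Z $ 1 / \<pi>\<^sub>2) *s l 2 + ((Z $ 2 - Z $ 1 / \<pi>\<^sub>2 * x) / \<pi>\<^sub>1) *s l 1" for Z
  have lin: "Vector_Spaces.linear (*s) (*s) \<phi>"
    unfolding \<phi>_def
    by unfold_locales (auto simp: vec_eq_iff field_simps add_divide_distrib diff_divide_distrib)
  interpret \<phi>: Vector_Spaces.linear "(*s)" "(*s)" \<phi> by (rule lin)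
  have \<phi>1: "\<phi> (vector [0, \<pi>\<^sub>1]) = l 1" using \<pi> by (simp add: \<phi>_def)
  have \<phi>2: "\<phi> (vector [\<pi>\<^sub>2, x]) = l 2" using \<pi> by (simp add: \<phi>_def)
  have \<phi>3: "\<phi> (vector [\<omega> * \<pi>\<^sub>2, y]) = l' 1" using \<pi> s by (simp add: \<phi>_def l'1 add.commute)
  have surj: "surj \<phi>"
  proof -
    have eq: "vec.span (range \<phi>) = range \<phi>"
      using \<phi>.span_image[of UNIV] by (simp add: vec.span_UNIV)
    have "range l \<subseteq> range \<phi>"
      unfolding range_l using \<phi>1 \<phi>2 by (metis insert_subset empty_subsetI rangeI)
    from vec.span_mono[OF this] show ?thesis unfolding basis eq by auto
  qed
  have inj: "inj \<phi>"
    using vec.linear_surj_imp_inj[OF lin surj] by simp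
  interpret \<phi>A: module_hom "A_scale \<iota>" "A_scale \<iota>" \<phi>
    by unfold_locales (simp_all add: A_scale_eq \<phi>.add \<phi>.scale)
  have "\<phi> ` A.span {vector [0, \<pi>\<^sub>1], vector [\<pi>\<^sub>2, x], vector [\<omega> * \<pi>\<^sub>2, y]} = L"
    unfolding \<phi>A.span_image[symmetric] span[symmetric] range by (simp add: \<phi>1 \<phi>2 \<phi>3)
  thus ?thesis unfolding lattice_isomorphic_def using lin inj surj by (blast intro: bijI)
qed

end

subsection \<open>The t-motive of the extension\<close>

lemma act_poly_eq_sum:
  assumes "vector_space (act_scalar M)" "degree p \<le> n"
  shows "act_poly M F p x = (\<Sum>j\<le>n. act_scalar M (coeff p j) ((F ^^ j) x))"
proof -
  interpret vector_space "act_scalar M" by fact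
  show ?thesis
    unfolding act_poly_def using assms(2)
    by (intro sum.mono_neutral_left) (auto simp: coeff_eq_0)
qed

lemma act_poly_add:
  assumes "vector_space (act_scalar M)"
  shows "act_poly M F (p + r) x = act_poly M F p x + act_poly M F r x"
proof -
  interpret vector_space "act_scalar M" by fact
  let ?n = "max (degree p) (degree r)"
  have "degree (p + r) \<le> ?n" by (rule degree_add_le_max)
  thus ?thesis
    using act_poly_eq_sum[OF assms, of _ ?n]
    by (simp add: scale_left_distrib sum.distrib)
qed

lemma act_poly_smult:
  assumes "vector_space (act_scalar M)"
  shows "act_poly M F (smult c p) x = act_scalar M c (act_poly M F p x)"
proof -
  interpret vector_space "act_scalar M" by fact
  show ?thesis
    using act_poly_eq_sum[OF assms degree_smult_le[of c p], of F x]
    by (simp add: act_poly_def scale_sum_right)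
qed

lemma act_poly_0:
  assumes "vector_space (act_scalar M)"
  shows "act_poly M F 0 x = 0"
proof -
  interpret vector_space "act_scalar M" by fact
  show ?thesis by (simp add: act_poly_def)
qed

lemma act_poly_1:
  assumes "vector_space (act_scalar M)"
  shows "act_poly M F 1 x = x"
proof -
  interpret vector_space "act_scalar M" by fact
  show ?thesis by (simp add: act_poly_def)
qed

text \<open>The hypotheses fit the action of T; that of \<tau> is only semilinear.\<close>

lemma act_poly_pCons:
  assumes "vector_space (act_scalar M)" and add: "\<And>x y. F (x + y) = F x + F y"
    and comm: "\<And>c x. F (act_scalar M c x) = act_scalar M c (F x)"
  shows "act_poly M F (pCons c p) x = act_scalar M c x + F (act_poly M F p x)"
proof -
  interpret vector_space "act_scalar M" by fact
  have F0: "F 0 = 0" using add[of 0 0] by simp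
  have F_sum: "F (sum g I) = (\<Sum>i\<in>I. F (g i))" for g :: "nat \<Rightarrow> _" and I
    by (induction I rule: infinite_finite_induct) (auto simp: F0 add)
  have "act_poly M F (pCons c p) x =
      (\<Sum>j\<le>Suc (degree p). act_scalar M (coeff (pCons c p) j) ((F ^^ j) x))"
    by (rule act_poly_eq_sum[OF assms(1)]) (rule degree_pCons_le)
  also have "\<dots> = act_scalar M c x + (\<Sum>j\<le>degree p. act_scalar M (coeff p j) ((F ^^ Suc j) x))"
    by (subst sum.atMost_Suc_shift) simp
  also have "(\<Sum>j\<le>degree p. act_scalar M (coeff p j) ((F ^^ Suc j) x)) = F (act_poly M F p x)"
    by (simp add: act_poly_def F_sum comm)
  finally show ?thesis .
qed

lemma pCons_coeff_0_poly_shift: "pCons (coeff p 0) (poly_shift 1 p) = p"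
  by (rule poly_eqI) (simp add: coeff_pCons coeff_poly_shift split: nat.split)

lemma vec_2_eqI:
  assumes "v $ 1 = w $ 1" "v $ 2 = w $ 2"
  shows "v = (w :: 'a^2)"
  using assms by (simp add: vec_eq_iff forall_2)

context C_infty_card
begin

definition frob_poly :: "'c poly \<Rightarrow> 'c poly" where
  "frob_poly p = map_poly (\<lambda>c. c ^ q) p"

text \<open>Right multiplication by the constant \<open>c\<close> of polynomials in \<open>\<tau>\<close>.\<close>

definition twist :: "'c \<Rightarrow> 'c poly \<Rightarrow> 'c poly" where
  "twist c p = (\<Sum>j\<le>degree p. monom (coeff p j * c ^ (q ^ j)) j)"

lemma coeff_frob_poly [simp]: "coeff (frob_poly p) n = coeff p n ^ q"
  by (simp add: frob_poly_def coeff_map_poly zero_power)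

lemma coeff_twist [simp]: "coeff (twist c p) n = coeff p n * c ^ (q ^ n)"
  by (auto simp: twist_def coeff_sum coeff_eq_0)

lemma frob_poly_add: "frob_poly (p + r) = frob_poly p + frob_poly r"
  by (rule poly_eqI) (simp add: add_power_q)

lemma frob_poly_smult: "frob_poly (smult c p) = smult (c ^ q) (frob_poly p)"
  by (rule poly_eqI) (simp add: power_mult_distrib)

lemma frob_poly_pCons: "frob_poly (pCons c p) = pCons (c ^ q) (frob_poly p)"
  by (rule poly_eqI) (simp add: coeff_pCons split: nat.split)

lemma frob_poly_0 [simp]: "frob_poly 0 = 0"
  by (rule poly_eqI) (simp add: zero_power)

lemma frob_poly_monom [simp]: "frob_poly (monom 1 n) = monom 1 n"
  by (rule poly_eqI) (simp add: zero_power)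

lemma twist_add: "twist c (p + r) = twist c p + twist c r"
  by (rule poly_eqI) (simp add: distrib_right)

lemma twist_smult: "twist c (smult d p) = smult d (twist c p)"
  by (rule poly_eqI) simp

lemma twist_0 [simp]: "twist c 0 = 0"
  by (rule poly_eqI) simp

lemma twist_1 [simp]: "twist c 1 = [:c:]"
  by (rule poly_eqI) (simp add: coeff_pCons split: nat.split)

lemma twist_monom: "twist c (monom d n) = monom (d * c ^ (q ^ n)) n"
  by (rule poly_eqI) simp

text \<open>Associativity of the skew polynomial ring: left multiplication by \<tau> commutes with
  right multiplication by c.\<close>

lemma twist_shift_frob_poly: "twist c (pCons 0 (frob_poly p)) = pCons 0 (frob_poly (twist c p))"
  by (rule poly_eqI)
    (simp add: coeff_pCons power_mult_distrib mult.commute[of q] split: nat.split flip: power_mult)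

text \<open>Vectors are rows of left polynomials in \<tau>, the coordinates with respect to e_1 and
  e_2. As T commutes with scalars and \<tau>, it multiplies the row from the right by the defining
  matrix: p \<theta> is \<open>twist \<theta> p\<close>, p \<tau> is \<open>pCons 0 p\<close> and p
  a \<tau> is \<open>pCons 0 (twist a p)\<close>. Left multiplication by \<tau> also raises
  coefficients to the q-th power.\<close>

definition ext_module :: "'c \<Rightarrow> ('c, 'c poly^2) anderson_module" where
  "ext_module a = \<lparr>
     act_scalar = (\<lambda>c v. \<chi> i. smult c (v $ i)),
     act_T = (\<lambda>v. vector
       [twist \<theta> (v $ 1) + pCons 0 (pCons 0 (v $ 1)) + pCons 0 (twist a (v $ 2)),
        twist \<theta> (v $ 2) + pCons 0 (v $ 2)]),
     act_tau = (\<lambda>v. \<chi> i. pCons 0 (frob_poly (v $ i)))\<rparr>"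

lemma ext_module_nth [simp]:
  "act_scalar (ext_module a) c v $ i = smult c (v $ i)"
  "act_T (ext_module a) v $ 1 =
     twist \<theta> (v $ 1) + pCons 0 (pCons 0 (v $ 1)) + pCons 0 (twist a (v $ 2))"
  "act_T (ext_module a) v $ 2 = twist \<theta> (v $ 2) + pCons 0 (v $ 2)"
  "act_tau (ext_module a) v $ i = pCons 0 (frob_poly (v $ i))"
  by (simp_all add: ext_module_def)

lemma vector_space_ext_module: "vector_space (act_scalar (ext_module a))"
  by unfold_locales (simp_all add: vec_eq_iff smult_add_right smult_add_left)

lemma ext_T_add: "act_T (ext_module a) (x + y) = act_T (ext_module a) x + act_T (ext_module a) y"
  by (rule vec_2_eqI) (simp_all add: twist_add)

lemma ext_T_scalar:
  "act_T (ext_module a) (act_scalar (ext_module a) c x) =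
     act_scalar (ext_module a) c (act_T (ext_module a) x)"
  by (rule vec_2_eqI) (simp_all add: twist_smult smult_add_right)

lemma ext_tau_T:
  "act_tau (ext_module a) (act_T (ext_module a) x) = act_T (ext_module a) (act_tau (ext_module a) x)"
  by (rule vec_2_eqI)
    (simp_all add: frob_poly_add frob_poly_pCons twist_shift_frob_poly zero_power)

lemma is_anderson_module_ext_module: "is_anderson_module CARD('k) (ext_module a)"
  unfolding is_anderson_module_def card_k[symmetric]
  by (auto simp: vector_space_ext_module ext_T_add ext_T_scalar ext_tau_T)
    (simp_all add: vec_eq_iff frob_poly_add frob_poly_smult)

lemma ext_tau_axis: "(act_tau (ext_module a) ^^ j) (axis i 1) = axis i (monom 1 j)"
proof (induction j)
  case (Suc j)
  have "act_tau (ext_module a) (axis i (monom 1 j)) = axis i (monom 1 (Suc j))"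
    by (simp add: vec_eq_iff axis_def monom_Suc)
  thus ?case by (simp add: Suc)
qed (simp add: axis_def one_pCons monom_0)

lemma ext_act_tau_poly: "act_poly (ext_module a) (act_tau (ext_module a)) p (axis i 1) = axis i p"
proof -
  have scal: "act_scalar (ext_module a) c (axis i (monom 1 j)) = axis i (monom c j)" for c j
    by (simp add: vec_eq_iff axis_def smult_monom)
  have "axis i p = axis i (\<Sum>j\<le>degree p. monom (coeff p j) j)"
    by (simp only: poly_as_sum_of_monoms)
  also have "\<dots> = (\<Sum>j\<le>degree p. axis i (monom (coeff p j) j))"
    by (simp add: vec_eq_iff axis_def)
  finally show ?thesis by (simp add: act_poly_def ext_tau_axis scal)
qed

lemma ext_tau_basis: "is_free_basis (ext_module a) (act_tau (ext_module a)) UNIV (\<lambda>i. axis i 1)"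
  unfolding is_free_basis_def ext_act_tau_poly
proof
  fix x :: "'c poly^2"
  have "(x = (\<Sum>i\<in>UNIV. axis i (p i))) \<longleftrightarrow> p = (\<lambda>i. x $ i)" for p
    by (auto simp: vec_eq_iff forall_2 sum_2 fun_eq_iff axis_def)
  thus "\<exists>!p. (\<forall>i. i \<notin> UNIV \<longrightarrow> p i = 0) \<and> x = (\<Sum>i\<in>UNIV. axis i (p i))" by simp
qed

lemma ext_tau_free: "free_of_rank (ext_module a) (act_tau (ext_module a)) 2"
  unfolding free_of_rank_def is_free_basis_def
proof (intro exI allI)
  fix x :: "'c poly^2"
  let ?e = "\<lambda>n::nat. axis (if n = 0 then 1 else 2) 1 :: 'c poly^2"
  have *: "(\<Sum>i<2. act_poly (ext_module a) (act_tau (ext_module a)) (p i) (?e i)) =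
      axis 1 (p 0) + axis 2 (p 1)" for p
    by (simp add: numeral_2_eq_2 lessThan_Suc ext_act_tau_poly add.commute)
  show "\<exists>!p. (\<forall>i. i \<notin> {..<2} \<longrightarrow> p i = 0) \<and>
      x = (\<Sum>i<2. act_poly (ext_module a) (act_tau (ext_module a)) (p i) (?e i))"
    unfolding *
  proof (rule ex1I[of _ "\<lambda>i. if i = 0 then x $ 1 else if i = 1 then x $ 2 else 0"])
    fix p :: "nat \<Rightarrow> 'c poly" assume p: "(\<forall>i. i \<notin> {..<2} \<longrightarrow> p i = 0) \<and> x = axis 1 (p 0) + axis 2 (p 1)"
    show "p = (\<lambda>i. if i = 0 then x $ 1 else if i = 1 then x $ 2 else 0)"
    proof
      fix i show "p i = (if i = 0 then x $ 1 else if i = 1 then x $ 2 else 0)"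
        using p by (cases "i < 2") (auto simp: axis_def less_2_cases_iff)
    qed
  qed (auto simp: vec_eq_iff forall_2 axis_def)
qed

text \<open>These are e_1, \<tau> e_1 and e_2: T raises the \<tau>-degree by 2 along e_1 and by 1
  along e_2, so these are the remainders of division by T.\<close>

definition ext_T_basis :: "nat \<Rightarrow> 'c poly^2" where
  "ext_T_basis n = (if n = 0 then axis 1 1 else if n = 1 then axis 1 (monom 1 1) else axis 2 1)"

definition ext_T_comb :: "'c \<Rightarrow> (nat \<Rightarrow> 'c poly) \<Rightarrow> 'c poly^2" where
  "ext_T_comb a p = (\<Sum>i<3. act_poly (ext_module a) (act_T (ext_module a)) (p i) (ext_T_basis i))"

lemma ext_T_comb_add: "ext_T_comb a (\<lambda>i. p i + r i) = ext_T_comb a p + ext_T_comb a r"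
  by (simp add: ext_T_comb_def act_poly_add[OF vector_space_ext_module] sum.distrib)

lemma ext_T_comb_smult:
  "ext_T_comb a (\<lambda>i. smult c (p i)) = act_scalar (ext_module a) c (ext_T_comb a p)"
proof -
  interpret vector_space "act_scalar (ext_module a)" by (rule vector_space_ext_module)
  show ?thesis
    by (simp add: ext_T_comb_def act_poly_smult[OF vector_space_ext_module] scale_sum_right)
qed

lemma ext_T_comb_pCons:
  "ext_T_comb a (\<lambda>i. pCons (c i) (p i)) =
     (\<Sum>i<3. act_scalar (ext_module a) (c i) (ext_T_basis i)) + act_T (ext_module a) (ext_T_comb a p)"
  by (simp add: ext_T_comb_def eval_nat_numeral
      act_poly_pCons[OF vector_space_ext_module ext_T_add ext_T_scalar] ext_T_add)

lemma ext_T_comb_unit: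
  assumes "k < 3"
  shows "ext_T_comb a (\<lambda>i. if i = k then 1 else 0) = ext_T_basis k"
proof -
  have "act_poly (ext_module a) (act_T (ext_module a)) (if i = k then 1 else 0) (ext_T_basis i) =
      (if i = k then ext_T_basis k else 0)" for i
    by (simp add: act_poly_0[OF vector_space_ext_module] act_poly_1[OF vector_space_ext_module])
  thus ?thesis using assms by (simp add: ext_T_comb_def)
qed

text \<open>At degree \<open>k + degree y\<close> only the shifted copy of y contributes.\<close>

lemma twist_shift_eq_0:
  assumes "twist c y + monom 1 k * y + r = 0" "degree r < k"
  shows "y = 0"
proof (rule ccontr)
  assume "y \<noteq> 0"
  have "coeff (twist c y + monom 1 k * y + r) (k + degree y) = coeff y (degree y)"
    using assms(2) by (auto simp: coeff_monom_mult coeff_eq_0)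
  thus False using assms(1) \<open>y \<noteq> 0\<close> by simp
qed

text \<open>Uniqueness of division by T with remainder. The second coordinate comes first because
  \<open>y $ 2\<close> also enters the first coordinate of T y.\<close>

lemma ext_T_remainder_unique:
  assumes "(\<Sum>i<3. act_scalar (ext_module a) (c i) (ext_T_basis i)) + act_T (ext_module a) y = 0"
  shows "y = 0" "\<And>i. i < 3 \<Longrightarrow> c i = 0"
proof -
  note eqs = arg_cong[OF assms, of "\<lambda>v. v $ 1"] arg_cong[OF assms, of "\<lambda>v. v $ 2"]
  have 2: "twist \<theta> (y $ 2) + monom 1 1 * (y $ 2) + [:c 2:] = 0"
    using eqs(2) by (simp add: eval_nat_numeral ext_T_basis_def axis_def monom_Suc monom_0 add_ac)
  hence y2: "y $ 2 = 0" by (rule twist_shift_eq_0) simp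
  have 1: "twist \<theta> (y $ 1) + monom 1 2 * (y $ 1) + [:c 0, c 1:] = 0"
    using eqs(1) y2 by (simp add: eval_nat_numeral ext_T_basis_def axis_def monom_Suc monom_0 add_ac)
  hence y1: "y $ 1 = 0" by (rule twist_shift_eq_0) (simp add: degree_pCons_eq_if)
  show "y = 0" using y1 y2 by (intro vec_2_eqI) auto
  have "c 2 = 0" "c 0 = 0" "c 1 = 0" using 1 2 y1 y2 by auto
  thus "c i = 0" if "i < 3" for i
    using that by (auto simp: eval_nat_numeral less_Suc_eq)
qed

text \<open>Constant coefficients form the remainder modulo T and the shifted polynomials the
  quotient, so vanishing passes from one coefficient to the next.\<close>

lemma ext_T_comb_eq_0:
  assumes "ext_T_comb a p = 0" "i < 3"
  shows "p i = 0"
proof -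
  have "coeff (p i) m = 0" for m
    using assms
  proof (induction m arbitrary: p)
    case (0 p)
    have "ext_T_comb a (\<lambda>i. pCons (coeff (p i) 0) (poly_shift 1 (p i))) = 0"
      by (simp only: pCons_coeff_0_poly_shift 0)
    from ext_T_remainder_unique(2)[OF this[unfolded ext_T_comb_pCons] \<open>i < 3\<close>] show ?case .
  next
    case (Suc m p)
    have "ext_T_comb a (\<lambda>i. pCons (coeff (p i) 0) (poly_shift 1 (p i))) = 0"
      by (simp only: pCons_coeff_0_poly_shift Suc.prems)
    from ext_T_remainder_unique(1)[OF this[unfolded ext_T_comb_pCons]]
    have "coeff (poly_shift 1 (p i)) m = 0" by (intro Suc.IH \<open>i < 3\<close>)
    thus ?case by (simp add: coeff_poly_shift)
  qed
  thus ?thesis by (intro poly_eqI) simp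
qed

text \<open>The span is stable under T and scalars, and T \<tau>^n e_1 contains \<tau>^(n+2) e_1
  next to a multiple of \<tau>^n e_1, so all \<tau>^n e_1 are reached. Those of e_2 follow
  afterwards, as T \<tau>^n e_2 also has a component along e_1.\<close>

lemma ext_T_comb_surj: "\<exists>p. x = ext_T_comb a p"
proof -
  interpret V: vector_space "act_scalar (ext_module a)" by (rule vector_space_ext_module)
  define S where "S = range (ext_T_comb a)"
  have add: "x + y \<in> S" if "x \<in> S" "y \<in> S" for x y
    using that unfolding S_def by (auto simp flip: ext_T_comb_add)
  have scal: "act_scalar (ext_module a) c x \<in> S" if "x \<in> S" for c x
    using that unfolding S_def by (auto simp flip: ext_T_comb_smult)
  have T: "act_T (ext_module a) x \<in> S" if "x \<in> S" for x
  proof -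
    obtain p where "x = ext_T_comb a p" using \<open>x \<in> S\<close> unfolding S_def by blast
    hence "act_T (ext_module a) x = ext_T_comb a (\<lambda>i. pCons 0 (p i))"
      by (simp only: ext_T_comb_pCons) simp
    thus ?thesis unfolding S_def by blast
  qed
  have basis: "ext_T_basis k \<in> S" if "k < 3" for k
    unfolding S_def using ext_T_comb_unit[OF that, of a] by (metis rangeI)
  have diff: "x - y \<in> S" if "x \<in> S" "y \<in> S" for x y
    using add[OF that(1) scal[OF that(2), of "- 1"]] by simp
  have m1: "axis 1 (monom 1 n) \<in> S" for n
  proof (induction n rule: less_induct)
    case (less n)
    consider "n = 0" | "n = 1" | m where "n = Suc (Suc m)" by (metis One_nat_def not0_implies_Suc)
    thus ?case
    proof cases
      case 1
      thus ?thesis using basis[of 0] by (simp add: ext_T_basis_def monom_0 one_pCons)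
    next
      case 2
      thus ?thesis using basis[of 1] by (simp add: ext_T_basis_def)
    next
      case (3 m)
      have "axis 1 (monom 1 n) = act_T (ext_module a) (axis 1 (monom 1 m)) -
          act_scalar (ext_module a) (\<theta> ^ (q ^ m)) (axis 1 (monom 1 m))"
        by (rule vec_2_eqI) (simp_all add: 3 axis_def twist_monom monom_Suc smult_monom)
      thus ?thesis using diff[OF T scal] less.IH[of m] 3 by simp
    qed
  qed
  have m2: "axis 2 (monom 1 n) \<in> S" for n
  proof (induction n)
    case 0
    show ?case using basis[of 2] by (simp add: ext_T_basis_def monom_0 one_pCons)
  next
    case (Suc n)
    have "axis 2 (monom 1 (Suc n)) = act_T (ext_module a) (axis 2 (monom 1 n)) -
        act_scalar (ext_module a) (\<theta> ^ (q ^ n)) (axis 2 (monom 1 n)) -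
        act_scalar (ext_module a) (a ^ (q ^ n)) (axis 1 (monom 1 (Suc n)))"
      by (rule vec_2_eqI) (simp_all add: axis_def twist_monom monom_Suc smult_monom)
    thus ?case using diff[OF diff[OF T scal] scal] Suc.IH m1 by simp
  qed
  have 0: "0 \<in> S" using scal[OF basis[of 0], of 0] by simp
  have ax: "axis i p \<in> S" for i :: 2 and p
  proof -
    have "axis i (monom 1 j) \<in> S" for j
      using exhaust_2[of i] m1[of j] m2[of j] by auto
    moreover have "sum f J \<in> S" if "\<And>j. f j \<in> S" for f and J :: "nat set"
      by (induction J rule: infinite_finite_induct) (auto simp: 0 add that)
    ultimately have "(\<Sum>j\<le>degree p. act_scalar (ext_module a) (coeff p j) (axis i (monom 1 j))) \<in> S"
      by (simp add: scal)
    thus ?thesis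
      using ext_act_tau_poly[of a p i] by (simp add: act_poly_def ext_tau_axis)
  qed
  have "x = axis 1 (x $ 1) + axis 2 (x $ 2)"
    by (rule vec_2_eqI) (simp_all add: axis_def)
  hence "x \<in> S" using add[OF ax ax] by metis
  thus ?thesis unfolding S_def by blast
qed

lemma ext_T_free: "free_of_rank (ext_module a) (act_T (ext_module a)) 3"
  unfolding free_of_rank_def is_free_basis_def
proof (intro exI allI)
  fix x :: "'c poly^2"
  obtain p where p: "x = ext_T_comb a p" using ext_T_comb_surj by blast
  define r where "r i = (if i < 3 then p i else 0)" for i
  show "\<exists>!p. (\<forall>i. i \<notin> {..<3} \<longrightarrow> p i = 0) \<and>
      x = (\<Sum>i<3. act_poly (ext_module a) (act_T (ext_module a)) (p i) (ext_T_basis i))"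
    unfolding ext_T_comb_def[symmetric]
  proof (rule ex1I[of _ r])
    have "ext_T_comb a p = ext_T_comb a r" by (simp add: ext_T_comb_def r_def)
    thus r: "(\<forall>i. i \<notin> {..<3} \<longrightarrow> r i = 0) \<and> x = ext_T_comb a r" by (simp add: r_def p)
    fix s assume s: "(\<forall>i. i \<notin> {..<3} \<longrightarrow> s i = 0) \<and> x = ext_T_comb a s"
    have "ext_T_comb a (\<lambda>i. (s i - r i) + r i) = ext_T_comb a (\<lambda>i. s i - r i) + ext_T_comb a r"
      by (rule ext_T_comb_add)
    hence "ext_T_comb a (\<lambda>i. s i - r i) = 0" using r s by simp
    from ext_T_comb_eq_0[OF this] have "s i = r i" if "i < 3" for i using that by simp
    moreover have "s i = r i" if "\<not> i < 3" for i using that r s by simp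
    ultimately show "s = r" by blast
  qed
qed

text \<open>T - \<theta> removes all constant coefficients, and over a perfect field the image of
  \<tau> consists of all vectors without them. Hence the nilpotency exponent is 1.\<close>

lemma ext_T_minus_theta_in_range_tau:
  "act_T (ext_module a) x - act_scalar (ext_module a) \<theta> x \<in> range (act_tau (ext_module a))"
proof -
  define v where "v = act_T (ext_module a) x - act_scalar (ext_module a) \<theta> x"
  have v0: "coeff (v $ i) 0 = 0" for i
  proof -
    have "\<forall>i. coeff (v $ i) 0 = 0"
      unfolding forall_2 by (simp add: v_def coeff_pCons mult.commute)
    thus ?thesis by blast
  qed
  \<comment> \<open>Inverse Frobenius on coefficients; \<open>map_poly\<close> requires that it send
    0 to 0.\<close>
  define root :: "'c \<Rightarrow> 'c" where "root c = (SOME d. d ^ q = c)" for c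
  have root: "root c ^ q = c" for c
    unfolding root_def by (rule someI_ex[OF nth_root_exists]) simp
  have root0: "root 0 = 0" using root[of 0] by simp
  define w :: "'c poly^2" where "w = (\<chi> i. map_poly root (poly_shift 1 (v $ i)))"
  have "act_tau (ext_module a) w $ i = v $ i" for i
    using v0[of i]
    by (intro poly_eqI) (simp add: w_def coeff_pCons coeff_map_poly root0 root coeff_poly_shift split: nat.split)
  hence "v = act_tau (ext_module a) w" by (simp add: vec_eq_iff)
  thus ?thesis unfolding v_def by blast
qed

lemma is_t_motive_ext_module: "is_t_motive \<iota> 3 2 (ext_module a)"
  unfolding is_t_motive_def
  using is_anderson_module_ext_module ext_T_free ext_tau_free ext_T_minus_theta_in_range_tau
  by (auto intro!: exI[of _ 1])

lemma is_presentation_ext_module: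
  "is_presentation \<iota> (ext_module a) (ext_matrices a) (\<lambda>i. axis i 1)"
proof -
  let ?M = "ext_module a"
  have len: "{..<length (ext_matrices a)} = {0, 1}"
    by (auto simp: ext_matrices_def)
  have mat: "ext_matrices a ! 0 = vector [vector [0, 0], vector [a, 1]]"
    "ext_matrices a ! 1 = vector [vector [1, 0], vector [0, 0]]"
    by (simp_all add: ext_matrices_def)
  have "act_T ?M (axis i 1) = act_scalar ?M \<theta> (axis i 1) +
      (\<Sum>k<length (ext_matrices a). \<Sum>j\<in>UNIV.
        act_scalar ?M (ext_matrices a ! k $ i $ j) (axis j (monom 1 (Suc k))))" (is "?l i = ?r i") for i
  proof -
    have r: "?r i = act_scalar ?M \<theta> (axis i 1) +
        (act_scalar ?M (ext_matrices a ! 0 $ i $ 1) (axis 1 (monom 1 1)) +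
         act_scalar ?M (ext_matrices a ! 0 $ i $ 2) (axis 2 (monom 1 1)) +
        (act_scalar ?M (ext_matrices a ! 1 $ i $ 1) (axis 1 (monom 1 2)) +
         act_scalar ?M (ext_matrices a ! 1 $ i $ 2) (axis 2 (monom 1 2))))" for i
      unfolding len sum_2 by (simp add: numeral_2_eq_2)
    have "?l 1 = ?r 1"
      unfolding r mat
      by (rule vec_2_eqI) (simp_all add: axis_def monom_Suc numeral_2_eq_2)
    moreover have "?l 2 = ?r 2"
      unfolding r mat
      by (rule vec_2_eqI) (simp_all add: axis_def monom_Suc numeral_2_eq_2)
    ultimately show ?thesis using exhaust_2[of i] by (elim disjE) (simp_all only:)
  qed
  thus ?thesis
    unfolding is_presentation_def ext_tau_axis using ext_tau_basis by blast
qed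

end

section \<open>Realisation of all small Siegel entries\<close>

lemma (in C_infty_card) ext_module_realises_siegel_matrix:
  assumes \<omega>: "\<omega> \<in> F_q2 \<iota> - F_q \<iota>"
  shows "\<exists>\<delta>>0. \<forall>s. absval s < \<delta> \<longrightarrow> (\<exists>a.
    uniformizable \<iota> (ext_module a) (ext_matrices a) \<and>
    (\<forall>L. has_siegel_matrix \<iota> L (vector [vector [s, \<omega>]] :: 'c^2^1) \<longrightarrow>
      lattice_isomorphic (L_module \<iota> (ext_matrices a)) L))"
proof -
  obtain \<pi>\<^sub>1 where \<pi>\<^sub>1: "\<pi>\<^sub>1 \<noteq> 0" "carlitz_exp 1 \<pi>\<^sub>1 = 0"
      "\<And>x. carlitz_exp 1 x = 0 \<Longrightarrow> period_span 1 \<pi>\<^sub>1 x"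
    using carlitz_period[of 1] by auto
  obtain \<pi>\<^sub>2 where \<pi>\<^sub>2: "\<pi>\<^sub>2 \<noteq> 0" "carlitz_exp 2 \<pi>\<^sub>2 = 0"
      "absval (\<pi>\<^sub>2 / \<theta>) > 1" "absval (\<pi>\<^sub>2 / \<theta>) \<le> q"
      "\<And>x. carlitz_exp 2 x = 0 \<Longrightarrow> period_span 2 \<pi>\<^sub>2 x"
    using carlitz_period[of 2] by auto
  obtain \<delta> where \<delta>: "\<delta> > 0" "\<And>s. absval s < \<delta> \<Longrightarrow> \<exists>a x y. absval a \<le> 1 \<and>
      carlitz_exp 1 x = - ext_exp a \<pi>\<^sub>2 \<and> carlitz_exp 1 y = - ext_exp a (\<omega> * \<pi>\<^sub>2) \<and> y - \<omega> * x = s * \<pi>\<^sub>1"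
    using ext_parameter_exists[OF \<omega> quasi_nonzero[OF \<pi>\<^sub>2(3,4)] \<pi>\<^sub>1(1)] by blast
  have "\<exists>a. uniformizable \<iota> (ext_module a) (ext_matrices a) \<and>
      (\<forall>L. has_siegel_matrix \<iota> L (vector [vector [s, \<omega>]] :: 'c^2^1) \<longrightarrow>
        lattice_isomorphic (L_module \<iota> (ext_matrices a)) L)" if s: "absval s < \<delta>" for s
  proof -
    obtain a x y where a: "absval a \<le> 1" and x: "carlitz_exp 1 x = - ext_exp a \<pi>\<^sub>2"
        and y: "carlitz_exp 1 y = - ext_exp a (\<omega> * \<pi>\<^sub>2)" and xy: "y - \<omega> * x = s * \<pi>\<^sub>1"
      using \<delta>(2)[OF s] by blast
    have L: "L_module \<iota> (ext_matrices a) =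
        module.span (A_scale \<iota>) {vector [0, \<pi>\<^sub>1], vector [\<pi>\<^sub>2, x], vector [\<omega> * \<pi>\<^sub>2, y]}"
      by (intro L_module_explicit[OF \<omega> a _ _ _ _ x y] \<pi>\<^sub>1(2,3) \<pi>\<^sub>2(2,5))
    have "A_rank \<iota> (L_module \<iota> (ext_matrices a)) 3"
      unfolding L
    by (rule A_rank_span[OF _ period_vectors_independent[OF \<omega> \<pi>\<^sub>1(1) \<pi>\<^sub>2(1)]]) simp
    hence "uniformizable \<iota> (ext_module a) (ext_matrices a)"
      unfolding uniformizable_def using ext_T_free by (intro exI[of _ 3] conjI)
    moreover have "lattice_isomorphic (L_module \<iota> (ext_matrices a)) L"
      if "has_siegel_matrix \<iota> L (vector [vector [s, \<omega>]] :: 'c^2^1)" for L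
      unfolding L by (rule period_lattice_isomorphic[OF \<pi>\<^sub>1(1) \<pi>\<^sub>2(1) xy that])
    ultimately show ?thesis by (intro exI[of _ a]) simp
  qed
  thus ?thesis using \<delta>(1) by blast
qed

theorem theorem3p4:
  fixes \<iota> :: "'k::finite_field fls \<Rightarrow> 'c::{alg_closed_field,complete_space}"
    and \<omega> :: 'c
  assumes "C_infty \<iota>"
    and "\<omega> \<in> F_q2 \<iota> - F_q \<iota>"
  shows "\<exists>U. open U \<and> 0 \<in> U \<and>
    (\<forall>s11\<in>U. \<exists>a11 a12 a21.
      let As = [vector [vector [a11, a12], vector [a21, 1]],
                vector [vector [1, 0], vector [0, 0]]] :: ('c^2^2) list
      in \<exists>(M :: ('c, 'c poly ^ 2) anderson_module) (e :: 2 \<Rightarrow> 'c poly ^ 2).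
        is_t_motive \<iota> 3 2 M \<and>
        is_presentation \<iota> M As e \<and>
        uniformizable \<iota> M As \<and>
        (\<forall>L. has_siegel_matrix \<iota> L (vector [vector [s11, \<omega>]] :: 'c^2^1) \<longrightarrow>
          lattice_isomorphic (L_module \<iota> As) L))"
proof -
  interpret C_infty_card \<iota> "CARD('k)"
    using assms(1) by (simp add: C_infty_card_def C_infty_card_axioms_def)
  obtain \<delta> where \<delta>: "\<delta> > 0" "\<And>s. absval s < \<delta> \<Longrightarrow> \<exists>a.
      uniformizable \<iota> (ext_module a) (ext_matrices a) \<and>
      (\<forall>L. has_siegel_matrix \<iota> L (vector [vector [s, \<omega>]] :: 'c^2^1) \<longrightarrow>
        lattice_isomorphic (L_module \<iota> (ext_matrices a)) L)"
    using ext_module_realises_siegel_matrix[OF assms(2)] by blast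
  show ?thesis
  proof (intro exI[of _ "ball 0 \<delta>"] conjI ballI)
    fix s11 :: 'c assume "s11 \<in> ball 0 \<delta>"
    hence "absval s11 < \<delta>" by (simp add: absval_def dist_commute)
    then obtain a where a: "uniformizable \<iota> (ext_module a) (ext_matrices a)"
        "\<forall>L. has_siegel_matrix \<iota> L (vector [vector [s11, \<omega>]] :: 'c^2^1) \<longrightarrow>
          lattice_isomorphic (L_module \<iota> (ext_matrices a)) L"
      using \<delta>(2) by blast
    show "\<exists>a11 a12 a21.
      let As = [vector [vector [a11, a12], vector [a21, 1]],
                vector [vector [1, 0], vector [0, 0]]] :: ('c^2^2) list
      in \<exists>(M :: ('c, 'c poly ^ 2) anderson_module) (e :: 2 \<Rightarrow> 'c poly ^ 2).
        is_t_motive \<iota> 3 2 M \<and>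
        is_presentation \<iota> M As e \<and>
        uniformizable \<iota> M As \<and>
        (\<forall>L. has_siegel_matrix \<iota> L (vector [vector [s11, \<omega>]] :: 'c^2^1) \<longrightarrow>
          lattice_isomorphic (L_module \<iota> As) L)"
      using is_t_motive_ext_module[of a] is_presentation_ext_module[of a] a
      unfolding Let_def ext_matrices_def
      by (intro exI[of _ 0] exI[of _ a] exI[of _ "ext_module a"] exI[of _ "\<lambda>i. axis i 1"] conjI)
  qed (use \<delta>(1) in auto)
qed

end
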